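(* Let $\mu=N_d(A)$ and $\nu=N_d(B)$ be two centered Gaussian measures on $\mathbb{R}^d$ with non-singular covariance matrices $A$ and $B$, let $\Sigma\in S_{2d}^{++}(\mathbb{R})$, $\varepsilon>0$, $\Gamma:=\Sigma^{-1}=\begin{pmatrix}\Gamma_{11}&\Gamma_{12}\\ \Gamma_{12}^T&\Gamma_{22}\end{pmatrix}$ (with $d\times d$ blocks) and $M_\varepsilon:=I_d-\varepsilon\Gamma_{12}$, assumed invertible. Then the entropic optimal transport cost $$W_\Sigma^\varepsilon(\mu,\nu):=\inf_{\pi\in\Pi(\mu,\nu)}\int_{\mathbb{R}^d\times\mathbb{R}^d}\|x-y\|^2\,d\pi(x,y)+2\varepsilon\,\mathrm{KL}(\pi\,|\,N_{2d}(\Sigma))$$ has the closed form expression $$\begin{aligned}W_\Sigma^{\varepsilon}(\mu,\nu)=\;&\mathrm{tr}(A)+\mathrm{tr}(B)-2\,\mathrm{tr}\left(\left(AM_\varepsilon BM_\varepsilon^T+\frac{\varepsilon^2}{4}I_d\right)^{1/2}\right)+\varepsilon\log\det\left(\left(AM_\varepsilon BM_\varepsilon^T+\frac{\varepsilon^2}{4}I_d\right)^{1/2}+\frac{\varepsilon}{2}I_d\right)\\&+\varepsilon\,\mathrm{tr}(\Gamma_{11}A)+\varepsilon\,\mathrm{tr}(\Gamma_{22}B)-\varepsilon\log\det(AB)-\varepsilon d-\varepsilon d\log(\varepsilon)-\varepsilon\log\det(\Sigma^{-1}).\end{aligned}$$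
   Context: $S_{k}^{++}(\mathbb{R})$ is the set of real symmetric positive-definite $k\times k$ matrices. $N_d(A)$ denotes the centered Gaussian measure on $\mathbb{R}^d$ with covariance $A$, and $N_{2d}(\Sigma)$ the centered Gaussian measure on $\mathbb{R}^d\times\mathbb{R}^d$ with covariance $\Sigma$. $\Pi(\mu,\nu)$ is the set of probability measures on $\mathbb{R}^d\times\mathbb{R}^d$ with first marginal $\mu$ and second marginal $\nu$. $\mathrm{KL}(\pi|\pi_{\mathrm{ref}}):=\int\log\left(\frac{d\pi}{d\pi_{\mathrm{ref}}}\right)d\pi$ if $\pi$ is absolutely continuous with respect to $\pi_{\mathrm{ref}}$, and $+\infty$ otherwise. The square root is defined by $$\left(AM_\varepsilon BM_\varepsilon^T+\tfrac{\varepsilon^2}{4}I_d\right)^{1/2}:=A^{1/2}\left(A^{1/2}M_\varepsilon BM_\varepsilon^TA^{1/2}+\tfrac{\varepsilon^2}{4}I_d\right)^{1/2}A^{-1/2},$$ where the square roots on the right are the usual positive-definite square roots of symmetric positive-definite matrices. *)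

theory Defs
  imports "HOL-Analysis.Analysis" "HOL-Probability.Probability"
begin

definition sym_pos_def :: "real^'n^'n \<Rightarrow> bool" where
  "sym_pos_def A \<longleftrightarrow> transpose A = A \<and> (\<forall>x. x \<noteq> 0 \<longrightarrow> 0 < x \<bullet> (A *v x))"

text \<open>A matrix of size \<open>2d\<close> is indexed by the sum type \<^typ>\<open>'d + 'd\<close>.\<close>

definition block_matrix ::
  "real^'d^'d \<Rightarrow> real^'d^'d \<Rightarrow> real^'d^'d \<Rightarrow> real^'d^'d \<Rightarrow> real^('d + 'd)^('d + 'd)" where
  "block_matrix P Q R S = (\<chi> i j.
     case i of
       Inl k \<Rightarrow> (case j of Inl l \<Rightarrow> P $ k $ l | Inr l \<Rightarrow> Q $ k $ l)
     | Inr k \<Rightarrow> (case j of Inl l \<Rightarrow> R $ k $ l | Inr l \<Rightarrow> S $ k $ l))"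

text \<open>The positive-definite square root, meaningful for symmetric positive-definite arguments.\<close>

definition msqrt :: "real^'n^'n \<Rightarrow> real^'n^'n" where
  "msqrt A = (THE S. sym_pos_def S \<and> S ** S = A)"

text \<open>\<open>(A M B M\<^sup>T + \<epsilon>\<^sup>2/4 I)\<^sup>1\<^sup>/\<^sup>2\<close>.  The radicand is in general not symmetric, so this is not an
  instance of \<^const>\<open>msqrt\<close> but is defined through conjugation by the square root of \<open>A\<close>.\<close>

definition cross_sqrt :: "real^'d^'d \<Rightarrow> real^'d^'d \<Rightarrow> real^'d^'d \<Rightarrow> real \<Rightarrow> real^'d^'d" where
  "cross_sqrt A B M \<epsilon> =
     msqrt A **
     msqrt (msqrt A ** M ** B ** transpose M ** msqrt A + (\<epsilon>\<^sup>2 / 4) *\<^sub>R mat 1) **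
     matrix_inv (msqrt A)"

text \<open>The centered Gaussian measure with covariance \<open>A\<close>; the density formula requires \<open>A\<close> to be
  symmetric positive definite.\<close>

definition gaussian :: "real^'n^'n \<Rightarrow> (real^'n) measure" where
  "gaussian A = density lborel
     (\<lambda>x. ennreal (exp (- (x \<bullet> (matrix_inv A *v x)) / 2) / sqrt ((2 * pi) ^ CARD('n) * det A)))"

text \<open>\<open>N\<^sub>2\<^sub>d(\<Sigma>)\<close> as a measure on \<open>\<real>\<^sup>d \<times> \<real>\<^sup>d\<close>, transported along the identification of
  \<open>\<real>\<^sup>2\<^sup>d\<close> with \<open>\<real>\<^sup>d \<times> \<real>\<^sup>d\<close>.\<close>

definition split_vec :: "real^('d + 'd) \<Rightarrow> (real^'d) \<times> (real^'d)" where
  "split_vec z = (\<chi> i. z $ Inl i, \<chi> i. z $ Inr i)"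

definition gaussian_prod :: "real^('d + 'd)^('d + 'd) \<Rightarrow> ((real^'d) \<times> (real^'d)) measure" where
  "gaussian_prod \<Sigma> = distr (gaussian \<Sigma>) borel split_vec"

definition couplings ::
  "'a::topological_space measure \<Rightarrow> 'b::topological_space measure \<Rightarrow> ('a \<times> 'b) measure set" where
  "couplings \<mu> \<nu> =
     {\<pi>. prob_space \<pi> \<and> sets \<pi> = sets borel \<and> distr \<pi> borel fst = \<mu> \<and> distr \<pi> borel snd = \<nu>}"

text \<open>\<open>KL(\<pi> | \<rho>)\<close>, with values in the extended reals.  The library's \<^const>\<open>KL_divergence\<close> is not
  used because its Bochner integral is \<open>0\<close> when the log-density is not integrable.  Here the
  integral is the difference of the integrals of the positive and the negative part; for
  probability measures \<open>\<pi>\<close> absolutely continuous with respect to \<open>\<rho>\<close> the latter is finite.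
  Note that \<^term>\<open>entropy_density (exp 1) \<rho> \<pi>\<close> is \<open>log (d\<pi>/d\<rho>)\<close> with the natural logarithm.\<close>

definition KL :: "'a measure \<Rightarrow> 'a measure \<Rightarrow> ereal" where
  "KL \<pi> \<rho> =
     (if absolutely_continuous \<rho> \<pi>
      then enn2ereal (\<integral>\<^sup>+ z. ennreal (entropy_density (exp 1) \<rho> \<pi> z) \<partial>\<pi>)
         - enn2ereal (\<integral>\<^sup>+ z. ennreal (- entropy_density (exp 1) \<rho> \<pi> z) \<partial>\<pi>)
      else \<infinity>)"

definition entropic_cost ::
  "real^('d + 'd)^('d + 'd) \<Rightarrow> real \<Rightarrow> (real^'d) measure \<Rightarrow> (real^'d) measure \<Rightarrow> ereal" where
  "entropic_cost \<Sigma> \<epsilon> \<mu> \<nu> =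
     (INF \<pi> \<in> couplings \<mu> \<nu>.
        enn2ereal (\<integral>\<^sup>+ (x, y). ennreal ((norm (x - y))\<^sup>2) \<partial>\<pi>)
        + ereal (2 * \<epsilon>) * KL \<pi> (gaussian_prod \<Sigma>))"

end

theory Submission
  imports Defs
begin

text \<open>
  Write \<open>\<rho> = N\<^sub>2\<^sub>d(\<Sigma>)\<close>.  The proof exhibits the optimal plan and certifies its optimality by a
  dual argument (\<open>entropic_duality\<close>).  Suppose that a coupling \<open>\<pi>\<^sup>*\<close> of \<open>\<mu>\<close> and \<open>\<nu>\<close> has
  a density \<open>exp h\<close> with respect to \<open>\<rho>\<close> for which \<open>\<parallel>x - y\<parallel>\<^sup>2 + 2 \<epsilon> h(x, y) = \<phi>(x) + \<psi>(y)\<close>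
  separates.  By Gibbs' inequality \<open>KL(\<pi> | \<rho>) \<ge> \<integral> h d\<pi>\<close> for every probability measure \<open>\<pi>\<close>
  that integrates \<open>h\<close>, with equality for \<open>\<pi>\<^sup>*\<close>.  Hence every coupling costs at least
  \<open>\<integral> \<phi> d\<mu> + \<integral> \<psi> d\<nu>\<close>, a number that depends only on the marginals, and \<open>\<pi>\<^sup>*\<close> attains it.

  The plan is sought among Gaussian densities proportional to
  \<open>exp (- (x \<bullet> X x - 2 x \<bullet> H y + y \<bullet> Y y) / 2)\<close>.  The mixed terms in \<open>x\<close> and \<open>y\<close> cancel in
  \<open>\<parallel>x - y\<parallel>\<^sup>2 + 2 \<epsilon> h\<close> exactly if \<open>H = M / \<epsilon>\<close> with \<open>M = I - \<epsilon> \<Gamma>\<^sub>1\<^sub>2\<close>.  Completing the square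
  in \<open>x\<close> and in \<open>y\<close>, the marginals are \<open>N(A)\<close> and \<open>N(B)\<close> exactly if
  \<open>Y = B\<^sup>-\<^sup>1 + H\<^sup>T X\<^sup>-\<^sup>1 H\<close> and \<open>X = A\<^sup>-\<^sup>1 + H Y\<^sup>-\<^sup>1 H\<^sup>T\<close> (\<open>gaussian_coupling\<close>).  In terms of
  \<open>Z = X\<^sup>-\<^sup>1\<close> these two equations amount to the Riccati equation
  \<open>A = Z + Z H B H\<^sup>T Z\<close> (\<open>woodbury\<close>).  With \<open>R = A\<^sup>1\<^sup>/\<^sup>2\<close> and
  \<open>T = (R M B M\<^sup>T R + \<epsilon>\<^sup>2/4 I)\<^sup>1\<^sup>/\<^sup>2\<close> its solution is \<open>Z = \<epsilon> R (T + \<epsilon>/2 I)\<^sup>-\<^sup>1 R\<close>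
  (\<open>schroedinger_matrix\<close>); this is where the square root of the statement comes from, as
  \<open>cross_sqrt\<close> is \<open>R T R\<^sup>-\<^sup>1\<close>.  The value is then read off from \<open>E (x \<bullet> F x) = tr (F A)\<close>
  (\<open>gaussian_quadratic_form\<close>) and from the normalizing constants of the two densities.

  The preparatory sections provide what this needs: the spectral theorem for real symmetric
  matrices (hence existence and uniqueness of square roots), the behaviour of Lebesgue measure
  under orthogonal and positive definite maps, and the representation of a Gaussian measure as
  an image of the standard one.
\<close>

section \<open>Diagonalization and square roots of symmetric matrices\<close>

text \<open>A maximizer \<open>v\<close> of the Rayleigh quotient \<open>x \<bullet> f x\<close> on the unit sphere of \<open>V\<close> is an
  eigenvector: the residual \<open>w = f v - l v\<close> is orthogonal to \<open>v\<close>, and moving from \<open>v\<close> in the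
  direction \<open>w\<close> would increase the quotient to first order unless \<open>w = 0\<close>.\<close>

lemma selfadjoint_eigenvector_in_subspace:
  fixes f :: "'a::euclidean_space \<Rightarrow> 'a"
  assumes f: "linear f" and sa: "\<And>x y. f x \<bullet> y = x \<bullet> f y"
    and V: "subspace V" "f ` V \<subseteq> V" "V \<noteq> {0}"
  obtains v l where "v \<in> V" "norm v = 1" "f v = l *\<^sub>R v"
proof -
  let ?S = "V \<inter> sphere 0 1"
  have "compact ?S"
    using closed_subspace[OF V(1)] by (auto intro: closed_Int_compact)
  moreover have "?S \<noteq> {}"
  proof -
    obtain w where w: "w \<in> V" "w \<noteq> 0"
      using V(3) subspace_0[OF V(1)] by auto
    then have "(1 / norm w) *\<^sub>R w \<in> ?S"
      using V(1) by (auto intro: subspace_scale)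
    then show ?thesis by blast
  qed
  moreover have "continuous_on ?S (\<lambda>x. x \<bullet> f x)"
    using linear_continuous_on[of f] f
    by (intro continuous_intros) (auto simp: linear_conv_bounded_linear)
  ultimately obtain v where v: "v \<in> ?S" "\<And>w. w \<in> ?S \<Longrightarrow> w \<bullet> f w \<le> v \<bullet> f v"
    using continuous_attains_sup by (metis (no_types, lifting))
  define l where "l = v \<bullet> f v"
  have vv: "v \<bullet> v = 1" "v \<in> V" using v(1) by (auto simp: norm_eq_1)
  have bound: "w \<bullet> f w \<le> l * (w \<bullet> w)" if "w \<in> V" for w
  proof (cases "w = 0")
    case False
    have "(1 / norm w) *\<^sub>R w \<in> ?S"
      using that False V(1) by (auto intro: subspace_scale)
    from v(2)[OF this] have "(w \<bullet> f w) / (norm w)^2 \<le> l"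
      by (simp add: l_def linear_scale[OF f] power2_eq_square divide_simps)
    then show ?thesis using False
      by (simp add: power2_norm_eq_inner divide_simps mult.commute)
  qed (simp add: linear_0[OF f])
  define w where "w = f v - l *\<^sub>R v"
  have wV: "w \<in> V"
    unfolding w_def using V vv by (auto intro: subspace_diff subspace_scale)
  have wv: "w \<bullet> v = 0"
    by (simp add: w_def inner_diff_left inner_diff_right vv l_def inner_commute)
  have wfv: "w \<bullet> f v = w \<bullet> w"
    using wv by (simp add: w_def inner_diff_right inner_diff_left inner_commute)
  have ineq: "2 * t * (w \<bullet> w) \<le> t\<^sup>2 * (l * (w \<bullet> w) - w \<bullet> f w)" for t
  proof -
    have "v + t *\<^sub>R w \<in> V" using V vv wV by (auto intro: subspace_add subspace_scale)
    from bound[OF this] have "v \<bullet> f v + 2 * t * (w \<bullet> f v) + t\<^sup>2 * (w \<bullet> f w)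
       \<le> l * (v \<bullet> v + 2 * t * (w \<bullet> v) + t\<^sup>2 * (w \<bullet> w))"
      by (simp add: linear_add[OF f] linear_scale[OF f] inner_add_left inner_add_right
        sa[of v w, symmetric] inner_commute power2_eq_square algebra_simps)
    then show ?thesis
      by (simp add: wv wfv vv l_def algebra_simps)
  qed
  define k where "k = l * (w \<bullet> w) - w \<bullet> f w"
  have "k \<ge> 0" using bound[OF wV] by (simp add: k_def)
  have "w \<bullet> w \<le> 0"
  proof -
    have "2 * t * (w \<bullet> w) \<le> t\<^sup>2 * k" for t using ineq k_def by simp
    \<comment> \<open>Any positive step below \<open>2 (w \<bullet> w) / k\<close> works; \<open>k + 1\<close> avoids the case \<open>k = 0\<close>.\<close>
    from this[of "(w \<bullet> w) / (k+1)"]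
    have "2 * (w \<bullet> w)\<^sup>2 / (k+1) \<le> (w \<bullet> w)\<^sup>2 / (k+1) * (k / (k+1))"
      by (simp add: power2_eq_square)
    moreover have "(w \<bullet> w)\<^sup>2 / (k+1) * (k / (k+1)) \<le> (w \<bullet> w)\<^sup>2 / (k+1)"
      using \<open>k \<ge> 0\<close> by (intro mult_left_le) auto
    ultimately have "(w \<bullet> w)\<^sup>2 / (k+1) \<le> 0" by simp
    then show ?thesis using \<open>k \<ge> 0\<close> by (simp add: divide_le_0_iff)
  qed
  then have "w = 0" by (metis inner_eq_zero_iff inner_ge_zero antisym)
  then have "f v = l *\<^sub>R v" by (simp add: w_def)
  with vv that show ?thesis by (auto simp: norm_eq_1)
qed

text \<open>The orthogonal complement in \<open>V\<close> of an eigenvector is again invariant, because \<open>f\<close> is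
  self-adjoint; this is what drives the induction on the dimension, and why the statement is
  about invariant subspaces instead of the whole space.\<close>

lemma selfadjoint_orthonormal_eigenbasis:
  fixes f :: "'a::euclidean_space \<Rightarrow> 'a"
  assumes f: "linear f" and sa: "\<And>x y. f x \<bullet> y = x \<bullet> f y"
    and V: "subspace V" "f ` V \<subseteq> V"
  obtains B where "B \<subseteq> V" "pairwise orthogonal B" "card B = dim V" "finite B"
    "\<And>b. b \<in> B \<Longrightarrow> norm b = 1 \<and> (\<exists>l. f b = l *\<^sub>R b)"
proof -
  have "\<exists>B. B \<subseteq> V \<and> pairwise orthogonal B \<and> card B = dim V \<and> finite B \<and>
    (\<forall>b\<in>B. norm b = 1 \<and> (\<exists>l. f b = l *\<^sub>R b))"
    using V
  proof (induction "dim V" arbitrary: V)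
    case 0
    then show ?case by (intro exI[of _ "{}"]) auto
  next
    case (Suc n)
    have "V \<noteq> {0}" using Suc(2) by auto
    then obtain v l where v: "v \<in> V" "norm v = 1" "f v = l *\<^sub>R v"
      using selfadjoint_eigenvector_in_subspace[OF f sa Suc.prems] by blast
    define W where "W = {x \<in> V. \<forall>y \<in> {v}. orthogonal y x}"
    have W_eq: "W = V \<inter> {x. v \<bullet> x = 0}" by (auto simp: W_def orthogonal_def)
    have W: "subspace W"
      unfolding W_eq using Suc.prems(1) subspace_hyperplane by (rule subspace_inter)
    have "dim {x \<in> V. \<forall>y \<in> span {v}. orthogonal y x} + dim (span {v}) = dim V"
      using v(1) Suc.prems(1)
      by (intro dim_subspace_orthogonal_to_vectors subspace_span span_minimal) auto
    moreover have "{x \<in> V. \<forall>y \<in> span {v}. orthogonal y x} = W"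
      by (auto simp: W_def orthogonal_def span_singleton)
    ultimately have "dim W + dim {v} = dim V"
      by (simp add: dim_span)
    moreover have "v \<noteq> 0" using v by auto
    ultimately have dW: "n = dim W" using Suc(2) by (simp add: dim_insert split: if_splits)
    have "f ` W \<subseteq> W"
    proof
      fix y assume "y \<in> f ` W"
      then obtain x where x: "x \<in> W" "y = f x" by auto
      have "v \<bullet> f x = 0" using x(1) sa[of v x] v(3) by (simp add: W_def orthogonal_def)
      then show "y \<in> W" using x Suc.prems(2) by (auto simp: W_def orthogonal_def)
    qed
    from Suc(1)[OF dW W this] obtain B where B: "B \<subseteq> W" "pairwise orthogonal B"
      "card B = dim W" "finite B" "\<forall>b\<in>B. norm b = 1 \<and> (\<exists>l. f b = l *\<^sub>R b)" by blast
    have "v \<notin> B" using B(1) v(2) by (auto simp: W_def orthogonal_def norm_eq_1)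
    then show ?case
      using B v dW Suc(2)
      by (intro exI[of _ "insert v B"])
        (auto simp: pairwise_insert W_def orthogonal_commute)
  qed
  with that show ?thesis by blast
qed

definition diag_mat :: "('n \<Rightarrow> real) \<Rightarrow> real^'n^'n" where
  "diag_mat d = (\<chi> i j. if i = j then d i else 0)"

lemma diag_mat_vector: "(diag_mat d *v x) $ i = d i * x $ i"
  by (simp add: diag_mat_def matrix_vector_mult_def if_distrib[of "\<lambda>z. z * _"] cong: if_cong)

lemma diag_mat_mult: "diag_mat c ** diag_mat d = diag_mat (\<lambda>i. c i * d i)"
  by (simp add: vec_eq_iff diag_mat_def matrix_matrix_mult_def if_distrib[of "\<lambda>z. z * _"] cong: if_cong)

lemma transpose_diag_mat: "transpose (diag_mat d) = diag_mat d"
  by (vector diag_mat_def transpose_def)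

lemma det_diag_mat: "det (diag_mat d) = prod d UNIV"
  by (subst det_diagonal) (auto simp: diag_mat_def)

text \<open>The eigenvectors, enumerated by the index type of the matrix, are the columns of \<open>P\<close>.\<close>

lemma symmetric_matrix_diagonalization:
  fixes A :: "real^'n^'n"
  assumes "transpose A = A"
  obtains P d where "orthogonal_matrix P" "A = P ** diag_mat d ** transpose P"
proof -
  obtain B where B: "pairwise orthogonal B" "card B = CARD('n)" "finite B"
     "\<And>b. b \<in> B \<Longrightarrow> norm b = 1 \<and> (\<exists>l. A *v b = l *\<^sub>R b)"
  proof (rule selfadjoint_orthonormal_eigenbasis[of "(*v) A" UNIV])
    show "(A *v x) \<bullet> y = x \<bullet> (A *v y)" for x y
      using dot_lmul_matrix[of x A y] assms by (metis transpose_matrix_vector)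
  qed (auto simp: matrix_vector_mul_linear)
  obtain b where b: "bij_betw b (UNIV::'n set) B"
    using B(2,3) by (metis finite_class.finite_UNIV finite_same_card_bij)
  then have bB: "b i \<in> B" for i by (auto simp: bij_betw_def)
  then have "\<forall>i. \<exists>l. A *v b i = l *\<^sub>R b i" using B(4) by blast
  from choice[OF this] obtain d where d: "\<And>i. A *v b i = d i *\<^sub>R b i" by auto
  define P :: "real^'n^'n" where "P = (\<chi> i j. b j $ i)"
  have col: "column j P = b j" for j by (simp add: P_def column_def vec_eq_iff)
  have "orthogonal (b i) (b j)" if "i \<noteq> j" for i j
    using pairwiseD[OF B(1) bB bB] b that by (metis bij_betw_def inj_eq)
  then have P: "orthogonal_matrix P"
    using bB B(4) by (simp add: orthogonal_matrix_orthonormal_columns col)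
  have "A ** P = P ** diag_mat d"
  proof -
    have "(A ** P) $ i $ j = (P ** diag_mat d) $ i $ j" for i j
    proof -
      have "(A ** P) $ i $ j = (A *v b j) $ i"
        by (simp add: matrix_matrix_mult_def matrix_vector_mult_def P_def)
      also have "\<dots> = (P ** diag_mat d) $ i $ j"
        by (simp add: d matrix_matrix_mult_def diag_mat_def P_def if_distrib[of "\<lambda>z. _ * z"] cong: if_cong)
      finally show ?thesis .
    qed
    then show ?thesis by (simp add: vec_eq_iff)
  qed
  then have "A = P ** diag_mat d ** transpose P"
    using P by (metis matrix_mul_assoc matrix_mul_rid orthogonal_matrix_def)
  with P that show ?thesis by blast
qed

lemma inner_matrix_vector_transpose: "(A *v x) \<bullet> y = x \<bullet> (transpose A *v y)"
  for A :: "real^'n^'m"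
  by (metis dot_lmul_matrix inner_commute transpose_matrix_vector transpose_transpose)

lemma sym_pos_def_mat_1: "sym_pos_def (mat 1)"
  by (simp add: sym_pos_def_def transpose_mat)

lemma sym_pos_def_scaleR: "sym_pos_def A \<Longrightarrow> c > 0 \<Longrightarrow> sym_pos_def (c *\<^sub>R A)"
  by (simp add: sym_pos_def_def transpose_scalar scaleR_matrix_vector_assoc[symmetric])

text \<open>The sum is definite even if \<open>N\<close> is singular, since the congruence term is still positive
  semidefinite.\<close>

lemma sym_pos_def_add_congruence:
  fixes A D :: "real^'n^'n"
  assumes "sym_pos_def A" "sym_pos_def D"
  shows "sym_pos_def (A + transpose N ** D ** N)"
proof -
  have t: "transpose (A + B) = transpose A + transpose B" for A B :: "real^'n^'n"
    by (simp add: vec_eq_iff transpose_def)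
  have "0 \<le> x \<bullet> ((transpose N ** D ** N) *v x)" for x
  proof -
    have "x \<bullet> ((transpose N ** D ** N) *v x) = (N *v x) \<bullet> (D *v (N *v x))"
      by (simp add: inner_matrix_vector_transpose matrix_vector_mul_assoc matrix_mul_assoc)
    also have "\<dots> \<ge> 0"
      using assms(2) by (cases "N *v x = 0") (auto simp: sym_pos_def_def intro: less_imp_le)
    finally show ?thesis .
  qed
  then show ?thesis
    using assms
    by (auto simp: sym_pos_def_def t matrix_transpose_mul matrix_mul_assoc matrix_vector_mult_add_rdistrib
      inner_add_right add_pos_nonneg)
qed

lemma sym_pos_def_congruence:
  assumes "sym_pos_def D" "invertible N"
  shows "sym_pos_def (transpose N ** D ** N)"
proof -
  have "0 < x \<bullet> ((transpose N ** D ** N) *v x)" if "x \<noteq> 0" for x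
  proof -
    have "N *v x \<noteq> 0"
      using that assms(2) by (metis invertible_def matrix_vector_mul_assoc matrix_vector_mul_lid mult_zero_right matrix_vector_mult_0_right)
    moreover have "x \<bullet> ((transpose N ** D ** N) *v x) = (N *v x) \<bullet> (D *v (N *v x))"
      by (simp add: inner_matrix_vector_transpose matrix_vector_mul_assoc matrix_mul_assoc)
    ultimately show ?thesis using assms(1) by (simp add: sym_pos_def_def)
  qed
  then show ?thesis
    using assms by (auto simp: sym_pos_def_def matrix_transpose_mul matrix_mul_assoc)
qed

lemma sym_pos_def_invertible:
  assumes "sym_pos_def A"
  shows "invertible A"
proof -
  have "x = 0" if "A *v x = 0" for x
    using that assms by (metis inner_zero_right less_irrefl sym_pos_def_def)
  then show ?thesis
    by (metis invertible_left_inverse matrix_left_invertible_ker)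
qed

lemma matrix_inv_mult:
  fixes A :: "real^'n^'n"
  assumes "invertible A"
  shows "A ** matrix_inv A = mat 1" "matrix_inv A ** A = mat 1"
  using someI_ex[OF assms[unfolded invertible_def]] by (auto simp: matrix_inv_def)

lemma matrix_inv_eqI:
  fixes A :: "real^'n^'n"
  assumes "A ** B = mat 1"
  shows "matrix_inv A = B"
proof -
  have "invertible A" using assms by (metis invertible_right_inverse)
  then show ?thesis
    by (metis assms matrix_inv_mult(2) matrix_mul_assoc matrix_mul_lid matrix_mul_rid)
qed

lemma matrix_add_rdistrib: "(A + B) ** C = A ** C + B ** C"
  for A B :: "real^'n^'m" and C :: "real^'p^'n"
  by (simp add: vec_eq_iff matrix_matrix_mult_def algebra_simps sum.distrib)

lemma matrix_sub_ldistrib: "A ** (B - C) = A ** B - A ** C"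
  for A :: "real^'n^'m" and B C :: "real^'p^'n"
  by (simp add: vec_eq_iff matrix_matrix_mult_def algebra_simps sum_subtractf)

lemma matrix_sub_rdistrib: "(A - B) ** C = A ** C - B ** C"
  for A B :: "real^'n^'m" and C :: "real^'p^'n"
  by (simp add: vec_eq_iff matrix_matrix_mult_def algebra_simps sum_subtractf)

lemma matrix_vector_mul_component: "(A *v axis i 1) $ j = A $ j $ i"
  for A :: "real^'n^'m"
  by (simp add: matrix_vector_mult_basis column_def)

lemma matrix_inv_mat_1: "matrix_inv (mat 1 :: real^'n^'n) = mat 1"
  by (rule matrix_inv_eqI) simp

lemma matrix_inv_matrix_inv: "invertible A \<Longrightarrow> matrix_inv (matrix_inv A) = A"
  for A :: "real^'n^'n"
  by (intro matrix_inv_eqI matrix_inv_mult)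

lemma transpose_matrix_inv:
  fixes A :: "real^'n^'n"
  assumes "invertible A"
  shows "transpose (matrix_inv A) = matrix_inv (transpose A)"
  by (metis assms matrix_inv_eqI matrix_inv_mult(2) matrix_transpose_mul transpose_mat)

lemma det_matrix_inv:
  fixes A :: "real^'n^'n"
  assumes "invertible A"
  shows "det (matrix_inv A) = 1 / det A"
proof -
  have "det A * det (matrix_inv A) = 1"
    by (metis assms det_I det_mul matrix_inv_mult(1))
  then show ?thesis by (simp add: divide_simps) (metis mult_zero_left zero_neq_one mult.commute)
qed

lemma sym_pos_def_matrix_inv:
  assumes "sym_pos_def A"
  shows "sym_pos_def (matrix_inv A)"
proof -
  note inv = sym_pos_def_invertible[OF assms]
  have t: "transpose (matrix_inv A) = matrix_inv A"
    using assms transpose_matrix_inv[OF inv] by (simp add: sym_pos_def_def)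
  have "sym_pos_def (transpose (matrix_inv A) ** A ** matrix_inv A)"
    using assms matrix_inv_mult[OF inv] by (intro sym_pos_def_congruence) (auto simp: invertible_def)
  then show ?thesis
    by (simp add: t matrix_inv_mult inv)
qed

lemma sym_pos_def_diagonalization:
  fixes A :: "real^'n^'n"
  assumes "sym_pos_def A"
  obtains P d where "orthogonal_matrix P" "\<And>i. 0 < d i" "A = P ** diag_mat d ** transpose P"
proof -
  obtain P d where P: "orthogonal_matrix P" "A = P ** diag_mat d ** transpose P"
    using symmetric_matrix_diagonalization assms by (auto simp: sym_pos_def_def)
  have PP: "transpose P ** P = mat 1" using P(1) by (simp add: orthogonal_matrix_def)
  have "0 < d i" for i
  proof -
    define x where "x = P *v axis i 1"
    have Px: "transpose P *v x = axis i 1"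
      by (simp add: x_def matrix_vector_mul_assoc PP)
    have "x \<noteq> 0" using Px by (metis axis_eq_0_iff matrix_vector_mult_0_right zero_neq_one)
    then have "0 < x \<bullet> (A *v x)" using assms by (simp add: sym_pos_def_def)
    also have "x \<bullet> (A *v x) = (transpose P *v x) \<bullet> (diag_mat d *v (transpose P *v x))"
      by (simp add: P(2) dot_lmul_matrix matrix_vector_mul_assoc[symmetric])
    also have "\<dots> = d i"
      unfolding Px by (simp add: inner_axis' diag_mat_vector)
    finally show ?thesis .
  qed
  with P that show ?thesis by blast
qed

lemma sym_pos_def_diag_mat:
  assumes "\<And>i. 0 < d i"
  shows "sym_pos_def (diag_mat d)"
proof -
  have "0 < x \<bullet> (diag_mat d *v x)" if "x \<noteq> 0" for x
  proof -
    have "\<exists>k. x $ k \<noteq> 0" using that by (auto simp: vec_eq_iff)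
    then obtain k where k: "x $ k \<noteq> 0" ..
    have "0 < (\<Sum>i\<in>UNIV. d i * (x $ i)\<^sup>2)"
      using assms k by (intro sum_pos2[of _ k]) (auto intro!: mult_nonneg_nonneg less_imp_le[OF assms])
    then show ?thesis
      by (simp add: inner_vec_def diag_mat_vector power2_eq_square algebra_simps)
  qed
  then show ?thesis by (simp add: sym_pos_def_def transpose_diag_mat)
qed

lemma sym_pos_def_det_pos:
  assumes "sym_pos_def A"
  shows "0 < det A"
proof -
  obtain P d where P: "orthogonal_matrix P" "\<And>i. 0 < d i" "A = P ** diag_mat d ** transpose P"
    using sym_pos_def_diagonalization[OF assms] by blast
  have "det P * det P = 1"
    using P(1) by (metis det_I det_mul det_transpose orthogonal_matrix)
  then have "det A = prod d UNIV"
    by (simp add: P(3) det_mul det_diag_mat)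
  then show ?thesis using P(2) by (simp add: prod_pos)
qed

text \<open>For \<open>D = S - T\<close> one has \<open>S D + D T = S\<^sup>2 - T\<^sup>2 = 0\<close>.  Hence
  \<open>0 = tr (D (S D + D T)) = tr (D (S + T) D)\<close>, which is the sum of the values of the positive
  definite form of \<open>S + T\<close> at the columns of \<open>D\<close>, so that all these columns vanish.\<close>

lemma sym_pos_def_sqrt_unique:
  fixes S T :: "real^'n^'n"
  assumes "sym_pos_def S" "sym_pos_def T" "S ** S = T ** T"
  shows "S = T"
proof -
  define D where "D = S - T"
  have D: "transpose D = D"
    using assms by (simp add: D_def sym_pos_def_def vec_eq_iff transpose_def)
  have "trace (D ** (S + T) ** D) = trace (D ** (S ** D + D ** T))"
    by (simp add: matrix_add_ldistrib matrix_add_rdistrib trace_add matrix_mul_assoc)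
      (metis matrix_mul_assoc trace_mul_sym)
  also have "S ** D + D ** T = 0"
    using assms(3) by (simp add: D_def matrix_sub_ldistrib matrix_sub_rdistrib)
  finally have "(\<Sum>i\<in>UNIV. (D ** (S + T) ** D) $ i $ i) = 0"
    by (simp add: trace_def)
  moreover have entry: "(D ** (S + T) ** D) $ i $ i
      = (D *v axis i 1) \<bullet> (S *v (D *v axis i 1)) + (D *v axis i 1) \<bullet> (T *v (D *v axis i 1))" for i
  proof -
    have "(D ** (S + T) ** D) $ i $ i = axis i 1 \<bullet> ((D ** (S + T) ** D) *v axis i 1)"
      by (simp add: inner_axis' matrix_vector_mul_component)
    also have "\<dots> = (D *v axis i 1) \<bullet> ((S + T) *v (D *v axis i 1))"
      using D by (metis inner_matrix_vector_transpose matrix_vector_mul_assoc)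
    finally show ?thesis by (simp add: matrix_vector_mult_add_rdistrib inner_add_right)
  qed
  have nn: "0 \<le> y \<bullet> (S *v y)" "0 \<le> y \<bullet> (T *v y)" for y
    using assms by (cases "y = 0"; force simp: sym_pos_def_def intro: less_imp_le)+
  ultimately have "(D ** (S + T) ** D) $ i $ i = 0" for i
    by (subst (asm) sum_nonneg_eq_0_iff) (auto simp: entry)
  then have "D *v axis i 1 = 0" for i
    using assms(1) nn entry[of i] by (metis add_nonneg_eq_0_iff less_irrefl sym_pos_def_def)
  then have "D = 0"
    by (simp add: matrix_vector_mult_basis vec_eq_iff column_def)
  then show ?thesis by (simp add: D_def)
qed

lemma ex_sym_pos_def_sqrt:
  fixes A :: "real^'n^'n"
  assumes "sym_pos_def A"
  shows "\<exists>S. sym_pos_def S \<and> S ** S = A"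
proof -
  obtain P d where P: "orthogonal_matrix P" "\<And>i. 0 < d i" "A = P ** diag_mat d ** transpose P"
    using sym_pos_def_diagonalization[OF assms] by blast
  define S where "S = P ** diag_mat (\<lambda>i. sqrt (d i)) ** transpose P"
  have inv: "invertible (transpose P)"
    using P(1) by (auto simp: orthogonal_matrix_def invertible_def)
  have "sym_pos_def (transpose (transpose P) ** diag_mat (\<lambda>i. sqrt (d i)) ** transpose P)"
    using P(2) inv by (intro sym_pos_def_congruence sym_pos_def_diag_mat) auto
  moreover have "S ** S = P ** diag_mat (\<lambda>i. sqrt (d i)) ** (transpose P ** P) ** diag_mat (\<lambda>i. sqrt (d i)) ** transpose P"
    by (simp add: S_def matrix_mul_assoc)
  then have "S ** S = P ** (diag_mat (\<lambda>i. sqrt (d i)) ** diag_mat (\<lambda>i. sqrt (d i))) ** transpose P"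
    using P(1) by (simp add: orthogonal_matrix) (simp add: matrix_mul_assoc)
  then have "S ** S = A"
    using P(2) by (simp add: diag_mat_mult P(3) less_imp_le)
  ultimately show ?thesis by (auto simp: S_def)
qed

lemma msqrt_sym_pos_def:
  assumes "sym_pos_def A"
  shows "sym_pos_def (msqrt A)" "msqrt A ** msqrt A = A"
proof -
  have "\<exists>!S. sym_pos_def S \<and> S ** S = A"
    using ex_sym_pos_def_sqrt[OF assms] sym_pos_def_sqrt_unique by metis
  from theI'[OF this] show "sym_pos_def (msqrt A)" "msqrt A ** msqrt A = A"
    by (auto simp: msqrt_def)
qed

section \<open>Lebesgue measure under linear maps\<close>

lemma nn_integral_lborel_translate:
  fixes f :: "'a::euclidean_space \<Rightarrow> ennreal"
  assumes [measurable]: "f \<in> borel_measurable borel"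
  shows "(\<integral>\<^sup>+ x. f (a + x) \<partial>lborel) = (\<integral>\<^sup>+ x. f x \<partial>lborel)"
  by (subst (2) lborel_distr_plus[of a, symmetric]) (simp add: nn_integral_distr)

lemma nn_integral_lborel_reflect:
  fixes f :: "'a::euclidean_space \<Rightarrow> ennreal"
  assumes [measurable]: "f \<in> borel_measurable borel"
  shows "(\<integral>\<^sup>+ x. f (a - x) \<partial>lborel) = (\<integral>\<^sup>+ x. f x \<partial>lborel)"
  by (subst (2) lborel_affine[of "-1" a]) (simp_all add: nn_integral_density nn_integral_distr)

text \<open>Uniqueness of Haar measure.  Computing the integral of
  \<open>indicator E x * indicator F (x + y)\<close> over \<open>x\<close> and \<open>y\<close> in both orders, with the invariance of
  either measure, gives \<open>M E * lborel F = M F * lborel E\<close>; then let \<open>F\<close> be the unit cube.\<close>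

lemma translation_invariant_eq_scaled_lborel:
  fixes M :: "'a::euclidean_space measure"
  assumes sets_M [measurable_cong]: "sets M = sets borel" and sf: "sigma_finite_measure M"
    and inv: "\<And>a. distr M borel ((+) a) = M"
  obtains c where "M = density lborel (\<lambda>_. c)"
proof -
  interpret M: sigma_finite_measure M by fact
  interpret pair_sigma_finite M "lborel :: 'a measure"
    by (simp add: pair_sigma_finite_def sf lborel.sigma_finite_measure_axioms)
  have shift: "(\<integral>\<^sup>+ x. f (a + x) \<partial>M) = (\<integral>\<^sup>+ x. f x \<partial>M)"
    if [measurable]: "f \<in> borel_measurable borel" for f and a :: 'a
    by (subst (2) inv[of a, symmetric]) (simp add: nn_integral_distr)
  have key: "emeasure M E * emeasure lborel F = emeasure M F * emeasure lborel E"
    if [measurable]: "E \<in> sets borel" "F \<in> sets borel" for E F :: "'a set"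
  proof -
    have "emeasure M E * emeasure lborel F = (\<integral>\<^sup>+ x. (\<integral>\<^sup>+ y. indicator E x * indicator F y \<partial>lborel) \<partial>M)"
      by (simp add: nn_integral_cmult nn_integral_multc sets_M)
    also have "\<dots> = (\<integral>\<^sup>+ x. (\<integral>\<^sup>+ y. indicator E x * indicator F (x + y) \<partial>lborel) \<partial>M)"
      by (simp add: nn_integral_cmult nn_integral_lborel_translate[of "indicator F"])
    also have "\<dots> = (\<integral>\<^sup>+ y. (\<integral>\<^sup>+ x. indicator E x * indicator F (x + y) \<partial>M) \<partial>lborel)"
      by (rule Fubini'[symmetric]) simp
    also have "\<dots> = (\<integral>\<^sup>+ y. (\<integral>\<^sup>+ x. indicator E (x - y) * indicator F x \<partial>M) \<partial>lborel)"
    proof (rule nn_integral_cong)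
      fix y :: 'a
      show "(\<integral>\<^sup>+ x. indicator E x * indicator F (x + y) \<partial>M) = (\<integral>\<^sup>+ x. indicator E (x - y) * indicator F x \<partial>M)"
        using shift[of "\<lambda>x. indicator E x * indicator F (x + y)" "- y"] by simp
    qed
    also have "\<dots> = (\<integral>\<^sup>+ x. (\<integral>\<^sup>+ y. indicator E (x - y) * indicator F x \<partial>lborel) \<partial>M)"
      by (rule Fubini') simp
    also have "\<dots> = emeasure M F * emeasure lborel E"
      by (simp add: nn_integral_multc nn_integral_lborel_reflect[of "indicator E"] nn_integral_cmult sets_M mult.commute)
    finally show ?thesis .
  qed
  define c where "c = emeasure M (cbox 0 One)"
  have "M = density lborel (\<lambda>_. c)"
  proof (rule measure_eqI)
    fix E assume "E \<in> sets M"
    then have E: "E \<in> sets borel" by (simp add: sets_M)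
    have "emeasure lborel (cbox 0 (One::'a)) = 1" by simp
    then show "emeasure M E = emeasure (density lborel (\<lambda>_. c)) E"
      using key[OF E, of "cbox 0 One"] E by (simp add: emeasure_density nn_integral_cmult c_def)
  qed (simp add: sets_M)
  then show ?thesis by (rule that)
qed

text \<open>The image measure is translation invariant, hence a multiple of Lebesgue measure, and
  the factor is 1 because an orthogonal transformation maps the unit ball onto itself.\<close>

lemma lborel_distr_orthogonal_transformation:
  fixes f :: "'a::euclidean_space \<Rightarrow> 'a"
  assumes f: "orthogonal_transformation f"
  shows "distr lborel borel f = lborel"
proof -
  have lin: "linear f" using f by (rule orthogonal_transformation_linear)
  have [measurable]: "f \<in> borel_measurable borel"
    using lin by (intro borel_measurable_continuous_onI linear_continuous_on) (simp add: linear_conv_bounded_linear)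
  let ?M = "distr lborel borel f"
  have ball: "emeasure ?M (ball 0 r) = emeasure lborel (ball (0::'a) r)" for r
  proof -
    have "f -` ball 0 r = ball 0 r"
      using f by (auto simp: orthogonal_transformation)
    then show ?thesis by (simp add: emeasure_distr)
  qed
  have fin: "emeasure lborel (ball (0::'a) r) \<noteq> \<top>" for r
    by (metis emeasure_lborel_ball_finite infinity_ennreal_def less_irrefl)
  have "sigma_finite_measure ?M"
  proof
    have "(\<Union>n. ball (0::'a) (real n)) = UNIV"
      by (auto simp: reals_Archimedean2)
    then show "\<exists>A. countable A \<and> A \<subseteq> sets ?M \<and> \<Union> A = space ?M \<and> (\<forall>a\<in>A. emeasure ?M a \<noteq> \<infinity>)"
      by (intro exI[of _ "range (\<lambda>n. ball 0 (real n))"])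
        (auto simp: ball fin)
  qed
  moreover have "distr ?M borel ((+) a) = ?M" for a
  proof -
    obtain b where b: "a = f b"
      using orthogonal_transformation_surj[OF f] by auto
    have "distr ?M borel ((+) a) = distr (distr lborel borel ((+) b)) borel f"
      by (simp add: distr_distr o_def b linear_add[OF lin])
    then show ?thesis by (simp add: lborel_distr_plus)
  qed
  ultimately obtain c where c: "?M = density lborel (\<lambda>_. c)"
    using translation_invariant_eq_scaled_lborel[of ?M] by auto
  have "emeasure lborel (ball (0::'a) 1) = c * emeasure lborel (ball (0::'a) 1)"
    using ball[of 1] unfolding c by (simp add: emeasure_density nn_integral_cmult_indicator)
  moreover have "emeasure lborel (ball (0::'a) 1) \<noteq> \<infinity>" "emeasure lborel (ball (0::'a) 1) \<noteq> 0"
    using fin content_ball_pos[of 1 "0::'a"] by (auto simp: measure_def)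
  ultimately have "c = 1"
    by (metis ennreal_divide_self infinity_ennreal_def mult_divide_eq_ennreal top.not_eq_extremum)
  then show ?thesis by (simp add: c density_1)
qed

lemma prod_Basis_cart: "prod f (Basis :: (real^'n) set) = (\<Prod>i\<in>UNIV. f (axis i 1))"
proof -
  have inj: "inj (\<lambda>i::'n. axis i (1::real))" by (auto simp: inj_on_def axis_eq_axis)
  moreover have "Basis = range (\<lambda>i::'n. axis i (1::real))" by (auto simp: Basis_vec_def)
  ultimately show ?thesis using prod.reindex[OF inj, of f] by (simp only: o_def)
qed

lemma lborel_distr_diag_mat:
  fixes d :: "'n::finite \<Rightarrow> real"
  assumes d: "\<And>i. 0 < d i"
  shows "distr lborel borel ((*v) (diag_mat d)) = density lborel (\<lambda>_. ennreal (1 / prod d UNIV))"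
proof -
  \<comment> \<open>On the basis vector \<open>axis i 1\<close> this is \<open>d i\<close>: the scaling factors as a function of the basis.\<close>
  let ?c = "\<lambda>b::real^'n. (\<chi> i. d i) \<bullet> b"
  let ?M = "distr lborel borel ((*v) (diag_mat d))"
  have T: "(*v) (diag_mat d) = (\<lambda>x. 0 + (\<Sum>j\<in>Basis. (?c j * (x \<bullet> j)) *\<^sub>R j))"
  proof
    fix x :: "real^'n"
    show "diag_mat d *v x = 0 + (\<Sum>j\<in>Basis. (?c j * (x \<bullet> j)) *\<^sub>R j)"
    proof (rule euclidean_eqI)
      fix b :: "real^'n" assume b: "b \<in> Basis"
      then have "(diag_mat d *v x) \<bullet> b = ?c b * (x \<bullet> b)"
        by (auto simp: Basis_vec_def inner_axis diag_mat_vector)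
      then show "(diag_mat d *v x) \<bullet> b = (0 + (\<Sum>j\<in>Basis. (?c j * (x \<bullet> j)) *\<^sub>R j)) \<bullet> b"
        using b by (simp add: inner_sum_left_Basis)
    qed
  qed
  have pos: "0 < prod d UNIV" using d by (simp add: prod_pos)
  have "lborel = density ?M (\<lambda>_. ennreal (prod d UNIV))"
  proof -
    have "?c j \<noteq> 0" if "j \<in> Basis" for j
      using that d by (auto simp: Basis_vec_def inner_axis less_imp_neq[symmetric])
    moreover have "(\<Prod>j\<in>Basis. \<bar>?c j\<bar>) = prod d UNIV"
      using d by (simp add: prod_Basis_cart inner_axis less_imp_le)
    ultimately show ?thesis
      unfolding T using lborel_affine_euclidean[of ?c 0] by simp
  qed
  then have "density lborel (\<lambda>_. ennreal (1 / prod d UNIV))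
      = density (density ?M (\<lambda>_. ennreal (prod d UNIV))) (\<lambda>_. ennreal (1 / prod d UNIV))"
    by simp
  also have "\<dots> = density ?M (\<lambda>_. ennreal (prod d UNIV) * ennreal (1 / prod d UNIV))"
    by (subst density_density_eq) auto
  also have "ennreal r * ennreal (1 / r) = 1" if "0 < r" for r
    using that by (simp add: ennreal_mult[symmetric])
  note this[OF pos]
  finally show ?thesis by (simp add: density_1)
qed

lemma measurable_matrix_vector_mult [measurable]: "(*v) A \<in> borel_measurable borel"
  for A :: "real^'n^'m"
  by (intro borel_measurable_continuous_onI linear_continuous_on) (simp add: matrix_vector_mul_bounded_linear)

lemma orthogonal_matrix_orthogonal_transformation:
  "orthogonal_matrix P \<Longrightarrow> orthogonal_transformation ((*v) P)" for P :: "real^'n^'n"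
  by (simp add: orthogonal_transformation_matrix matrix_vector_mul_linear)

text \<open>By diagonalization, an orthogonal map followed by a scaling of the coordinates and the inverse
  orthogonal map; only the scaling contributes to the factor.\<close>

lemma lborel_distr_sym_pos_def:
  fixes A :: "real^'n^'n"
  assumes "sym_pos_def A"
  shows "distr lborel borel ((*v) A) = density lborel (\<lambda>_. ennreal (1 / det A))"
proof -
  obtain P d where P: "orthogonal_matrix P" "\<And>i. 0 < d i" "A = P ** diag_mat d ** transpose P"
    using sym_pos_def_diagonalization[OF assms] by blast
  have "det P * det P = 1"
    using P(1) by (metis det_I det_mul det_transpose orthogonal_matrix)
  then have det: "det A = prod d UNIV"
    by (simp add: P(3) det_mul det_diag_mat)
  have inv: "distr lborel borel ((*v) Q) = lborel" if "orthogonal_matrix Q" for Q :: "real^'n^'n"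
    using that by (intro lborel_distr_orthogonal_transformation orthogonal_matrix_orthogonal_transformation)
  have "distr lborel borel ((*v) A)
     = distr (distr (distr lborel borel ((*v) (transpose P))) borel ((*v) (diag_mat d))) borel ((*v) P)"
    by (simp add: distr_distr o_def P(3) matrix_vector_mul_assoc matrix_mul_assoc del: transpose_matrix_vector)
  also have "\<dots> = distr (density lborel (\<lambda>_. ennreal (1 / det A))) borel ((*v) P)"
    using P(1) inv[of "transpose P"] by (simp add: lborel_distr_diag_mat P(2) det)
  also have "\<dots> = density (distr lborel borel ((*v) P)) (\<lambda>_. ennreal (1 / det A))"
    by (subst density_distr) simp_all
  finally show ?thesis using inv[OF P(1)] by simp
qed

section \<open>Gaussian measures\<close>

lemma gaussian_mat_1: "gaussian (mat 1 :: real^'n^'n) =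
   density lborel (\<lambda>x. \<Prod>i\<in>UNIV. ennreal (std_normal_density (x $ i)))"
proof -
  have "exp (- (x \<bullet> x) / 2) / sqrt ((2 * pi) ^ CARD('n)) = (\<Prod>i\<in>UNIV. std_normal_density (x $ i))"
    for x :: "real^'n"
  proof -
    have "exp (- (x \<bullet> x) / 2) = (\<Prod>i\<in>UNIV. exp (- (x $ i)\<^sup>2 / 2))"
      by (simp add: inner_vec_def exp_sum[symmetric] sum_negf sum_divide_distrib power2_eq_square)
    then show ?thesis
      by (simp add: std_normal_density_def prod.distrib prod_dividef real_sqrt_power real_sqrt_mult power_mult_distrib)
  qed
  then show ?thesis
    by (simp add: gaussian_def matrix_inv_mat_1 prod_ennreal)
qed

lemma sets_gaussian [simp, measurable_cong]: "sets (gaussian A) = sets borel"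
  by (simp add: gaussian_def)

lemma space_gaussian [simp]: "space (gaussian A) = UNIV"
  by (simp add: gaussian_def)

text \<open>Reduces every question about \<open>gaussian A\<close> to the standard Gaussian measure, whose
  density is a product.  The constant in the definition of \<^const>\<open>gaussian\<close> is right because
  \<open>det A\<close> is the square of \<open>det (msqrt A)\<close>.\<close>

lemma gaussian_eq_distr:
  fixes A :: "real^'n^'n"
  assumes A: "sym_pos_def A"
  shows "gaussian A = distr (gaussian (mat 1)) borel ((*v) (msqrt A))"
proof -
  define R where "R = msqrt A"
  note R = msqrt_sym_pos_def[OF A, folded R_def]
  note invR = sym_pos_def_invertible[OF R(1)]
  define h where "h = (\<lambda>y. ennreal (exp (- ((matrix_inv R *v y) \<bullet> (matrix_inv R *v y)) / 2) / sqrt ((2 * pi) ^ CARD('n))))"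
  have [measurable]: "h \<in> borel_measurable borel"
    unfolding h_def by measurable
  have "gaussian (mat 1) = density lborel (\<lambda>x. h (R *v x))"
    by (simp add: gaussian_def h_def matrix_inv_mat_1 matrix_vector_mul_assoc matrix_inv_mult invR)
  then have "distr (gaussian (mat 1)) borel ((*v) R) = density (distr lborel borel ((*v) R)) h"
    by (subst density_distr) simp_all
  also have "\<dots> = density lborel (\<lambda>y. ennreal (1 / det R) * h y)"
    by (simp add: lborel_distr_sym_pos_def R density_density_eq)
  also have "(\<lambda>y. ennreal (1 / det R) * h y) = (\<lambda>x. ennreal (exp (- (x \<bullet> (matrix_inv A *v x)) / 2) / sqrt ((2 * pi) ^ CARD('n) * det A)))"
  proof
    fix y :: "real^'n"
    have pos: "det R > 0" using sym_pos_def_det_pos R by blast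
    have "det A = (det R)\<^sup>2" unfolding R(2)[symmetric] det_mul by (simp add: power2_eq_square)
    then have s: "sqrt ((2 * pi) ^ CARD('n) * det A) = sqrt ((2 * pi) ^ CARD('n)) * det R"
      using pos by (simp add: real_sqrt_mult)
    have "matrix_inv A = matrix_inv R ** matrix_inv R"
    proof (rule matrix_inv_eqI)
      have "A ** (matrix_inv R ** matrix_inv R) = R ** (R ** matrix_inv R) ** matrix_inv R"
        by (simp only: R(2)[symmetric] matrix_mul_assoc)
      then show "A ** (matrix_inv R ** matrix_inv R) = mat 1"
        by (simp add: matrix_inv_mult invR)
    qed
    moreover have "transpose (matrix_inv R) = matrix_inv R"
      using sym_pos_def_matrix_inv[OF R(1)] by (simp add: sym_pos_def_def)
    ultimately have q: "(matrix_inv R *v y) \<bullet> (matrix_inv R *v y) = y \<bullet> (matrix_inv A *v y)"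
      by (metis inner_matrix_vector_transpose matrix_vector_mul_assoc)
    show "ennreal (1 / det R) * h y = ennreal (exp (- (y \<bullet> (matrix_inv A *v y)) / 2) / sqrt ((2 * pi) ^ CARD('n) * det A))"
      unfolding h_def q s using pos by (simp add: ennreal_mult[symmetric] mult.commute)
  qed
  finally show ?thesis by (simp add: gaussian_def R_def)
qed

lemma nn_integral_gaussian_mat_1_prod:
  fixes g :: "'n::finite \<Rightarrow> real \<Rightarrow> ennreal"
  assumes [measurable]: "\<And>i. g i \<in> borel_measurable borel"
  shows "(\<integral>\<^sup>+ x. (\<Prod>i\<in>UNIV. g i (x $ i)) \<partial>gaussian (mat 1))
    = (\<Prod>i\<in>UNIV. (\<integral>\<^sup>+ t. ennreal (std_normal_density t) * g i t \<partial>lborel))"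
proof -
  \<comment> \<open>Basis vectors are \<open>axis i 1\<close>; the choice operator recovers the index \<open>i\<close>.\<close>
  let ?f = "\<lambda>b t. ennreal (std_normal_density t) * g (SOME i. b = axis i (1::real)) t"
  have some: "(SOME i. axis k 1 = axis i (1::real)) = k" for k :: 'n
    by (rule some_equality) (auto simp: axis_eq_axis)
  have "(\<integral>\<^sup>+ x. (\<Prod>i\<in>UNIV. g i (x $ i)) \<partial>gaussian (mat 1))
      = (\<integral>\<^sup>+ x. (\<Prod>b\<in>Basis. ?f b (x \<bullet> b)) \<partial>lborel)"
    unfolding gaussian_mat_1
    by (subst nn_integral_density) (simp_all add: prod_Basis_cart some inner_axis prod.distrib)
  also have "\<dots> = (\<Prod>b\<in>(Basis :: (real^'n) set). (\<integral>\<^sup>+ t. ?f b t \<partial>lborel))"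
    by (rule nn_integral_lborel_prod) auto
  also have "\<dots> = (\<Prod>i\<in>UNIV. (\<integral>\<^sup>+ t. ennreal (std_normal_density t) * g i t \<partial>lborel))"
    by (simp add: prod_Basis_cart some)
  finally show ?thesis .
qed

lemma nn_integral_std_normal_density: "(\<integral>\<^sup>+ t. ennreal (std_normal_density t) \<partial>lborel) = 1"
  by (subst nn_integral_eq_integral) auto

lemma nn_integral_std_normal_square:
  "(\<integral>\<^sup>+ t. ennreal (std_normal_density t) * ennreal (t\<^sup>2) \<partial>lborel) = 1"
proof -
  have "(\<integral>\<^sup>+ t. ennreal (std_normal_density t * t\<^sup>2) \<partial>lborel) = 1"
    using std_normal_moment_even[of 1]
    by (subst nn_integral_eq_integral) (auto simp: has_bochner_integral_iff fact_numeral)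
  then show ?thesis by (simp add: ennreal_mult)
qed

lemma prob_space_gaussian:
  assumes "sym_pos_def A"
  shows "prob_space (gaussian A)"
proof -
  interpret std: prob_space "gaussian (mat 1 :: real^'n^'n)"
    using nn_integral_gaussian_mat_1_prod[of "\<lambda>_ _. 1"]
    by (intro prob_spaceI) (simp add: nn_integral_std_normal_density)
  show ?thesis
    unfolding gaussian_eq_distr[OF assms] by (intro std.prob_space_distr) simp
qed

lemma gaussian_mat_1_second_moment:
  "has_bochner_integral (gaussian (mat 1)) (\<lambda>x :: real^'n. (x $ k)\<^sup>2) 1"
proof (rule has_bochner_integral_nn_integral)
  have "(\<integral>\<^sup>+ x. ennreal (((x :: real^'n) $ k)\<^sup>2) \<partial>gaussian (mat 1))
     = (\<integral>\<^sup>+ x. (\<Prod>i\<in>UNIV. (if i = k then ennreal (((x :: real^'n) $ i)\<^sup>2) else 1)) \<partial>gaussian (mat 1))"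
    by simp
  also have "\<dots> = (\<Prod>i\<in>UNIV. (\<integral>\<^sup>+ t. ennreal (std_normal_density t) * (if i = k then ennreal (t\<^sup>2) else 1) \<partial>lborel))"
    by (rule nn_integral_gaussian_mat_1_prod) simp
  also have "\<dots> = 1"
  proof (intro prod.neutral ballI)
    fix i
    show "(\<integral>\<^sup>+ t. ennreal (std_normal_density t) * (if i = k then ennreal (t\<^sup>2) else 1) \<partial>lborel) = 1"
      by (cases "i = k") (simp_all add: nn_integral_std_normal_square nn_integral_std_normal_density)
  qed
  finally show "(\<integral>\<^sup>+ x. ennreal (((x :: real^'n) $ k)\<^sup>2) \<partial>gaussian (mat 1)) = ennreal 1" by simp
qed auto

lemma gaussian_mat_1_orthogonal:
  fixes P :: "real^'n^'n"
  assumes P: "orthogonal_matrix P"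
  shows "distr (gaussian (mat 1)) borel ((*v) P) = gaussian (mat 1)"
proof -
  let ?h = "\<lambda>x::real^'n. ennreal (exp (- (x \<bullet> x) / 2) / sqrt ((2 * pi) ^ CARD('n)))"
  have g: "gaussian (mat 1) = density lborel ?h" by (simp add: gaussian_def matrix_inv_mat_1)
  note ot = orthogonal_matrix_orthogonal_transformation[OF P]
  have "?h x = ?h (P *v x)" for x
    using ot by (simp add: orthogonal_transformation_def)
  then have "gaussian (mat 1) = density lborel (\<lambda>x. ?h (P *v x))" unfolding g by simp
  then have "distr (gaussian (mat 1)) borel ((*v) P) = density (distr lborel borel ((*v) P)) ?h"
    by (subst density_distr) simp_all
  then show ?thesis by (simp add: lborel_distr_orthogonal_transformation ot g)
qed

text \<open>For the standard Gaussian measure one may replace the matrix by its symmetric part and,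
  by rotation invariance, assume it to be diagonal; then only the second moments of the
  coordinates are left.  The general case follows
  from \<open>tr (A\<^sup>1\<^sup>/\<^sup>2 F A\<^sup>1\<^sup>/\<^sup>2) = tr (F A)\<close>.\<close>

lemma gaussian_quadratic_form:
  fixes A F :: "real^'n^'n"
  assumes A: "sym_pos_def A"
  shows "has_bochner_integral (gaussian A) (\<lambda>x. x \<bullet> (F *v x)) (trace (F ** A))"
proof -
  have std: "has_bochner_integral (gaussian (mat 1)) (\<lambda>x. x \<bullet> (G *v x)) (trace G)"
    for G :: "real^'n^'n"
  proof -
    define W where "W = (1/2) *\<^sub>R (G + transpose G)"
    have W: "transpose W = W" by (simp add: W_def vec_eq_iff transpose_def)
    have GW: "x \<bullet> (G *v x) = x \<bullet> (W *v x)" for x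
      using inner_matrix_vector_transpose[of G x x]
      by (simp add: W_def scaleR_matrix_vector_assoc[symmetric] matrix_vector_mult_add_rdistrib
        inner_add_right inner_commute del: transpose_matrix_vector)
    have trW: "trace W = trace G"
      by (simp add: W_def trace_def transpose_def sum.distrib sum_divide_distrib[symmetric])
    obtain P d where P: "orthogonal_matrix P" "W = P ** diag_mat d ** transpose P"
      using symmetric_matrix_diagonalization[OF W] by blast
    have PP: "transpose P ** P = mat 1" using P by (simp add: orthogonal_matrix)
    have "trace W = trace (diag_mat d ** (transpose P ** P))"
      unfolding P(2) by (metis matrix_mul_assoc trace_mul_sym)
    then have trd: "trace W = (\<Sum>i\<in>UNIV. d i)"
      by (simp add: PP) (simp add: trace_def diag_mat_def)
    have q: "(P *v x) \<bullet> (W *v (P *v x)) = (\<Sum>i\<in>UNIV. d i * (x $ i)\<^sup>2)" for x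
    proof -
      have "(P *v x) \<bullet> (W *v (P *v x)) = x \<bullet> ((transpose P ** P) ** diag_mat d ** (transpose P ** P) *v x)"
        by (simp only: P(2) inner_matrix_vector_transpose matrix_vector_mul_assoc matrix_mul_assoc)
      then show ?thesis
        by (simp add: PP inner_vec_def diag_mat_vector power2_eq_square algebra_simps)
    qed
    have "has_bochner_integral (gaussian (mat 1)) (\<lambda>x. \<Sum>i\<in>UNIV. d i * (x $ i)\<^sup>2) (\<Sum>i\<in>UNIV. d i * 1)"
      by (intro has_bochner_integral_sum has_bochner_integral_mult_right gaussian_mat_1_second_moment)
    then have "has_bochner_integral (gaussian (mat 1)) (\<lambda>x. (P *v x) \<bullet> (W *v (P *v x))) (trace W)"
      by (simp add: q trd)
    then have "has_bochner_integral (distr (gaussian (mat 1)) borel ((*v) P)) (\<lambda>x. x \<bullet> (W *v x)) (trace W)"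
      by (subst has_bochner_integral_iff, subst integrable_distr_eq, simp, simp,
        subst integral_distr, simp, simp) (simp add: has_bochner_integral_iff)
    then show ?thesis by (simp add: gaussian_mat_1_orthogonal P(1) GW trW)
  qed
  define R where "R = msqrt A"
  note R = msqrt_sym_pos_def[OF A, folded R_def]
  have "(R *v x) \<bullet> (F *v (R *v x)) = x \<bullet> ((R ** F ** R) *v x)" for x
    using R(1) by (simp only: sym_pos_def_def inner_matrix_vector_transpose matrix_vector_mul_assoc matrix_mul_assoc)
  moreover have "trace (R ** F ** R) = trace (F ** A)"
    unfolding R(2)[symmetric] by (metis matrix_mul_assoc trace_mul_sym)
  ultimately have "has_bochner_integral (gaussian (mat 1)) (\<lambda>x. (R *v x) \<bullet> (F *v (R *v x))) (trace (F ** A))"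
    using std[of "R ** F ** R"] by simp
  then show ?thesis
    unfolding gaussian_eq_distr[OF A] R_def[symmetric]
    by (subst has_bochner_integral_iff, subst integrable_distr_eq, simp, simp,
        subst integral_distr, simp, simp) (simp add: has_bochner_integral_iff)
qed

section \<open>Relative entropy and duality for entropic transport\<close>

lemma ereal_integral_eq_nn_integral_diff:
  fixes g :: "'a \<Rightarrow> real"
  assumes "integrable M g"
  shows "ereal (\<integral>x. g x \<partial>M)
    = enn2ereal (\<integral>\<^sup>+ x. ennreal (g x) \<partial>M) - enn2ereal (\<integral>\<^sup>+ x. ennreal (- g x) \<partial>M)"
proof -
  have "(\<integral>\<^sup>+ x. ennreal (g x) \<partial>M) \<noteq> \<infinity>" "(\<integral>\<^sup>+ x. ennreal (- g x) \<partial>M) \<noteq> \<infinity>"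
    using assms by (auto simp: real_integrable_def)
  then show ?thesis
    unfolding real_lebesgue_integral_def[OF assms]
    by (cases "\<integral>\<^sup>+ x. ennreal (g x) \<partial>M"; cases "\<integral>\<^sup>+ x. ennreal (- g x) \<partial>M") (auto simp: enn2ereal_ennreal)
qed

text \<open>Gibbs' inequality.  With \<open>f = d\<pi>/d\<rho>\<close> and \<open>j = exp h / f\<close>, the elementary bound
  \<open>ln j \<le> j - 1\<close> reads \<open>ln f \<ge> h + 1 - j\<close>, and \<open>\<integral> j d\<pi> \<le> \<integral> exp h d\<rho> \<le> 1\<close>.  The minorant
  \<open>h + 1 - j\<close> is integrable, so the estimate also covers the case in which the positive part of
  \<open>ln f\<close> has infinite integral.\<close>

lemma KL_ge_integral:
  fixes h :: "'a \<Rightarrow> real"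
  assumes \<pi>: "prob_space \<pi>" and \<rho>: "sigma_finite_measure \<rho>" and sets [measurable_cong]: "sets \<pi> = sets \<rho>"
    and h [measurable]: "h \<in> borel_measurable \<rho>" and int: "integrable \<pi> h"
    and le1: "(\<integral>\<^sup>+ z. ennreal (exp (h z)) \<partial>\<rho>) \<le> 1"
  shows "ereal (\<integral>z. h z \<partial>\<pi>) \<le> KL \<pi> \<rho>"
proof (cases "absolutely_continuous \<rho> \<pi>")
  case ac: True
  interpret \<pi>: prob_space \<pi> by fact
  interpret \<rho>: sigma_finite_measure \<rho> by fact
  define f where "f = RN_deriv \<rho> \<pi>"
  have [measurable]: "f \<in> borel_measurable \<rho>" by (simp add: f_def)
  have dens: "density \<rho> f = \<pi>"
    unfolding f_def using ac sets by (rule \<rho>.density_RN_deriv)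
  define L where "L = entropy_density (exp 1) \<rho> \<pi>"
  have L: "L z = ln (enn2real (f z))" for z
    by (simp add: L_def entropy_density_def f_def log_def)
  have [measurable]: "L \<in> borel_measurable \<rho>" by (simp add: L_def)
  \<comment> \<open>Where \<open>f\<close> is 0 or infinite, \<open>j\<close> is 0 by convention, which keeps \<open>f * j \<le> exp h\<close> valid everywhere.\<close>
  define j where "j z = exp (h z) / enn2real (f z)" for z
  have [measurable]: "j \<in> borel_measurable \<rho>" unfolding j_def by measurable
  have "(\<integral>\<^sup>+ z. ennreal (j z) \<partial>\<pi>) = (\<integral>\<^sup>+ z. f z * ennreal (j z) \<partial>\<rho>)"
    by (subst dens[symmetric]) (simp add: nn_integral_density)
  also have "\<dots> \<le> (\<integral>\<^sup>+ z. ennreal (exp (h z)) \<partial>\<rho>)"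
  proof (rule nn_integral_mono)
    fix z
    show "f z * ennreal (j z) \<le> ennreal (exp (h z))"
      by (cases "f z") (auto simp: j_def ennreal_mult[symmetric])
  qed
  also note le1
  finally have j1: "(\<integral>\<^sup>+ z. ennreal (j z) \<partial>\<pi>) \<le> 1" .
  have jpos: "0 \<le> j z" for z by (simp add: j_def)
  have j_int: "integrable \<pi> j"
    using j1 jpos by (intro integrableI_nonneg) (auto intro: order.strict_trans1)
  have j_le: "(\<integral>z. j z \<partial>\<pi>) \<le> 1"
    using j1 jpos j_int by (subst (asm) nn_integral_eq_integral) auto
  define g where "g z = h z + 1 - j z" for z
  have g_int: "integrable \<pi> g"
    unfolding g_def using int j_int by auto
  have "(\<integral>z. g z \<partial>\<pi>) = (\<integral>z. h z \<partial>\<pi>) + 1 - (\<integral>z. j z \<partial>\<pi>)"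
    unfolding g_def using int j_int by (simp add: \<pi>.prob_space)
  then have g_ge: "(\<integral>z. h z \<partial>\<pi>) \<le> (\<integral>z. g z \<partial>\<pi>)" using j_le by simp
  have AE: "AE z in \<pi>. g z \<le> L z"
  proof -
    have "AE z in \<rho>. f z \<noteq> \<infinity>"
      unfolding f_def using \<rho>.RN_deriv_finite[OF \<pi>.sigma_finite_measure_axioms ac sets] .
    then have "AE z in \<rho>. 0 < f z \<longrightarrow> g z \<le> L z"
    proof eventually_elim
      case (elim z)
      show ?case
      proof
        assume "0 < f z"
        then have fz: "0 < enn2real (f z)" using elim by (cases "f z") auto
        then have "ln (j z) = h z - L z" by (simp add: j_def L ln_div)
        moreover have "ln (j z) \<le> j z - 1" using fz by (intro ln_le_minus_one) (simp add: j_def)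
        ultimately show "g z \<le> L z" by (simp add: g_def)
      qed
    qed
    then show ?thesis
      by (subst dens[symmetric]) (simp add: AE_density)
  qed
  have pos: "(\<integral>\<^sup>+ z. ennreal (g z) \<partial>\<pi>) \<le> (\<integral>\<^sup>+ z. ennreal (L z) \<partial>\<pi>)"
    using AE by (intro nn_integral_mono_AE) (auto intro: ennreal_leI)
  have neg: "(\<integral>\<^sup>+ z. ennreal (- L z) \<partial>\<pi>) \<le> (\<integral>\<^sup>+ z. ennreal (- g z) \<partial>\<pi>)"
    using AE by (intro nn_integral_mono_AE) (auto elim!: eventually_mono intro: ennreal_leI)
  have "ereal (\<integral>z. h z \<partial>\<pi>) \<le> ereal (\<integral>z. g z \<partial>\<pi>)" using g_ge by simp
  also have "\<dots> \<le> enn2ereal (\<integral>\<^sup>+ z. ennreal (L z) \<partial>\<pi>) - enn2ereal (\<integral>\<^sup>+ z. ennreal (- L z) \<partial>\<pi>)"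
    unfolding ereal_integral_eq_nn_integral_diff[OF g_int]
    using pos neg by (intro ereal_minus_mono) (auto simp: less_eq_ennreal.rep_eq)
  finally show ?thesis using ac by (simp add: KL_def L_def)
qed (simp add: KL_def)

lemma KL_density_exp:
  fixes h :: "'a \<Rightarrow> real"
  assumes \<rho>: "sigma_finite_measure \<rho>" and h [measurable]: "h \<in> borel_measurable \<rho>"
    and \<pi>: "\<pi> = density \<rho> (\<lambda>z. ennreal (exp (h z)))" and int: "integrable \<pi> h"
  shows "KL \<pi> \<rho> = ereal (\<integral>z. h z \<partial>\<pi>)"
proof -
  interpret \<rho>: sigma_finite_measure \<rho> by fact
  have ac: "absolutely_continuous \<rho> \<pi>"
    unfolding \<pi> by (intro absolutely_continuousI_density) simp
  have "AE z in \<rho>. ennreal (exp (h z)) = RN_deriv \<rho> \<pi> z"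
    by (intro \<rho>.RN_deriv_unique) (simp_all add: \<pi>)
  then have "AE z in \<pi>. ennreal (exp (h z)) = RN_deriv \<rho> \<pi> z"
    unfolding \<pi> by (subst AE_density) auto
  then have AE: "AE z in \<pi>. entropy_density (exp 1) \<rho> \<pi> z = h z"
  proof eventually_elim
    case (elim z)
    show ?case unfolding entropy_density_def comp_def elim[symmetric] by (simp add: log_def)
  qed
  have 1: "(\<integral>\<^sup>+ z. ennreal (entropy_density (exp 1) \<rho> \<pi> z) \<partial>\<pi>) = (\<integral>\<^sup>+ z. ennreal (h z) \<partial>\<pi>)"
    using AE by (intro nn_integral_cong_AE) auto
  have 2: "(\<integral>\<^sup>+ z. ennreal (- entropy_density (exp 1) \<rho> \<pi> z) \<partial>\<pi>) = (\<integral>\<^sup>+ z. ennreal (- h z) \<partial>\<pi>)"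
    using AE by (intro nn_integral_cong_AE) auto
  show ?thesis
    using ac by (simp add: KL_def 1 2 ereal_integral_eq_nn_integral_diff[OF int])
qed

lemma borel_measurable_fst_snd [measurable]:
  "fst \<in> borel_measurable (borel :: ('a::topological_space \<times> 'b::topological_space) measure)"
  "snd \<in> borel_measurable (borel :: ('a::topological_space \<times> 'b::topological_space) measure)"
  by (auto intro!: borel_measurable_continuous_onI continuous_intros)

text \<open>If a coupling has a density of the form \<open>exp ((\<phi>(x) + \<psi>(y) - c(x, y)) / (2 \<epsilon>))\<close> with
  respect to the reference measure, it is optimal: on every coupling the dual potentials
  \<open>\<phi>\<close> and \<open>\<psi>\<close> integrate to the same value, which bounds the cost from below by Gibbs' inequality
  and is the cost of the given coupling.\<close>

lemma entropic_duality:
  fixes \<mu> :: "'a::euclidean_space measure" and \<nu> :: "'b::euclidean_space measure"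
    and \<rho> :: "('a \<times> 'b) measure" and c :: "'a \<times> 'b \<Rightarrow> real"
  assumes \<rho>: "sigma_finite_measure \<rho>" "sets \<rho> = sets borel" and \<epsilon>: "0 < \<epsilon>"
    and c [measurable]: "c \<in> borel_measurable borel" and c_nonneg: "\<And>z. 0 \<le> c z"
    and c_int: "\<And>\<pi>. \<pi> \<in> couplings \<mu> \<nu> \<Longrightarrow> integrable \<pi> c"
    and \<phi>_meas [measurable]: "\<phi> \<in> borel_measurable borel" and \<psi>_meas [measurable]: "\<psi> \<in> borel_measurable borel"
    and \<phi>: "integrable \<mu> \<phi>" and \<psi>: "integrable \<nu> \<psi>"
    and opt: "density \<rho> (\<lambda>z. ennreal (exp ((\<phi> (fst z) + \<psi> (snd z) - c z) / (2 * \<epsilon>)))) \<in> couplings \<mu> \<nu>"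
  shows "(INF \<pi> \<in> couplings \<mu> \<nu>. enn2ereal (\<integral>\<^sup>+ z. ennreal (c z) \<partial>\<pi>) + ereal (2 * \<epsilon>) * KL \<pi> \<rho>)
    = ereal ((\<integral>x. \<phi> x \<partial>\<mu>) + (\<integral>y. \<psi> y \<partial>\<nu>))"
proof -
  define g where "g z = (\<phi> (fst z) + \<psi> (snd z) - c z) / (2 * \<epsilon>)" for z
  define V where "V = (\<integral>x. \<phi> x \<partial>\<mu>) + (\<integral>y. \<psi> y \<partial>\<nu>)"
  have [measurable]: "g \<in> borel_measurable borel"
    unfolding g_def[abs_def] by measurable
  note [measurable_cong] = \<rho>(2)
  \<comment> \<open>On couplings, \<open>c + 2 \<epsilon> g\<close> always integrates to \<open>V\<close>, as it is a sum of functions of one variable.\<close>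
  have coup: "integrable \<pi> g \<and> (\<integral>z. c z \<partial>\<pi>) + 2 * \<epsilon> * (\<integral>z. g z \<partial>\<pi>) = V
      \<and> enn2ereal (\<integral>\<^sup>+ z. ennreal (c z) \<partial>\<pi>) = ereal (\<integral>z. c z \<partial>\<pi>)"
    if \<pi>: "\<pi> \<in> couplings \<mu> \<nu>" for \<pi>
  proof -
    have [measurable_cong]: "sets \<pi> = sets borel" and
      m: "distr \<pi> borel fst = \<mu>" "distr \<pi> borel snd = \<nu>"
      using \<pi> by (auto simp: couplings_def)
    have 1: "integrable \<pi> (\<lambda>z. \<phi> (fst z))" "(\<integral>z. \<phi> (fst z) \<partial>\<pi>) = (\<integral>x. \<phi> x \<partial>\<mu>)"
      using \<phi> unfolding m(1)[symmetric] by (simp_all add: integrable_distr_eq integral_distr)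
    have 2: "integrable \<pi> (\<lambda>z. \<psi> (snd z))" "(\<integral>z. \<psi> (snd z) \<partial>\<pi>) = (\<integral>x. \<psi> x \<partial>\<nu>)"
      using \<psi> unfolding m(2)[symmetric] by (simp_all add: integrable_distr_eq integral_distr)
    note ci = c_int[OF \<pi>]
    have "integrable \<pi> g" unfolding g_def[abs_def] using 1 2 ci by auto
    moreover have "(\<integral>z. g z \<partial>\<pi>) = (V - (\<integral>z. c z \<partial>\<pi>)) / (2 * \<epsilon>)"
      unfolding g_def[abs_def] using 1 2 ci by (simp add: V_def)
    moreover have "enn2ereal (\<integral>\<^sup>+ z. ennreal (c z) \<partial>\<pi>) = ereal (\<integral>z. c z \<partial>\<pi>)"
      using ci c_nonneg by (simp add: nn_integral_eq_integral enn2ereal_ennreal integral_nonneg)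
    ultimately show ?thesis using \<epsilon> by simp
  qed
  let ?\<pi> = "density \<rho> (\<lambda>z. ennreal (exp (g z)))"
  have opt': "?\<pi> \<in> couplings \<mu> \<nu>" using opt by (simp add: g_def)
  have mass: "(\<integral>\<^sup>+ z. ennreal (exp (g z)) \<partial>\<rho>) \<le> 1"
  proof -
    have "prob_space ?\<pi>" using opt' by (simp add: couplings_def)
    then have "emeasure ?\<pi> (space ?\<pi>) = 1" by (rule prob_space.emeasure_space_1)
    then show ?thesis by (simp add: emeasure_density)
  qed
  have "(INF \<pi> \<in> couplings \<mu> \<nu>. enn2ereal (\<integral>\<^sup>+ z. ennreal (c z) \<partial>\<pi>) + ereal (2 * \<epsilon>) * KL \<pi> \<rho>) = ereal V"
  proof (rule antisym)
    have "KL ?\<pi> \<rho> = ereal (\<integral>z. g z \<partial>?\<pi>)"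
      using coup[OF opt'] \<rho> by (intro KL_density_exp) auto
    then have eq: "enn2ereal (\<integral>\<^sup>+ z. ennreal (c z) \<partial>?\<pi>) + ereal (2 * \<epsilon>) * KL ?\<pi> \<rho> = ereal V"
      using coup[OF opt'] by simp
    show "(INF \<pi> \<in> couplings \<mu> \<nu>. enn2ereal (\<integral>\<^sup>+ z. ennreal (c z) \<partial>\<pi>) + ereal (2 * \<epsilon>) * KL \<pi> \<rho>) \<le> ereal V"
      unfolding eq[symmetric] by (rule INF_lower[OF opt'])
  next
    show "ereal V \<le> (INF \<pi> \<in> couplings \<mu> \<nu>. enn2ereal (\<integral>\<^sup>+ z. ennreal (c z) \<partial>\<pi>) + ereal (2 * \<epsilon>) * KL \<pi> \<rho>)"
    proof (rule INF_greatest)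
      fix \<pi> assume \<pi>: "\<pi> \<in> couplings \<mu> \<nu>"
      have "ereal (\<integral>z. g z \<partial>\<pi>) \<le> KL \<pi> \<rho>"
        using coup[OF \<pi>] \<pi> \<rho> mass by (intro KL_ge_integral) (auto simp: couplings_def)
      then have "ereal (2 * \<epsilon>) * ereal (\<integral>z. g z \<partial>\<pi>) \<le> ereal (2 * \<epsilon>) * KL \<pi> \<rho>"
        using \<epsilon> by (intro ereal_mult_left_mono) auto
      then have "ereal (\<integral>z. c z \<partial>\<pi>) + ereal (2 * \<epsilon>) * ereal (\<integral>z. g z \<partial>\<pi>)
          \<le> ereal (\<integral>z. c z \<partial>\<pi>) + ereal (2 * \<epsilon>) * KL \<pi> \<rho>"
        by (rule add_left_mono)
      then show "ereal V \<le> enn2ereal (\<integral>\<^sup>+ z. ennreal (c z) \<partial>\<pi>) + ereal (2 * \<epsilon>) * KL \<pi> \<rho>"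
        using coup[OF \<pi>] by simp
    qed
  qed
  then show ?thesis by (simp add: V_def)
qed

section \<open>The Gaussian reference measure and Gaussian couplings\<close>

lemma sum_UNIV_Plus: "(\<Sum>k\<in>UNIV. f k) = (\<Sum>i\<in>UNIV. f (Inl i)) + (\<Sum>i\<in>UNIV. f (Inr i))"
  for f :: "'a::finite + 'b::finite \<Rightarrow> 'c::comm_monoid_add"
  using sum.Plus[of "UNIV :: 'a set" "UNIV :: 'b set" f] by (simp add: UNIV_Plus_UNIV o_def)

lemma prod_UNIV_Plus: "(\<Prod>k\<in>UNIV. f k) = (\<Prod>i\<in>UNIV. f (Inl i)) * (\<Prod>i\<in>UNIV. f (Inr i))"
  for f :: "'a::finite + 'b::finite \<Rightarrow> 'c::comm_monoid_mult"
  using prod.Plus[of "UNIV :: 'a set" "UNIV :: 'b set" f] by (simp add: UNIV_Plus_UNIV o_def)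

lemma quadratic_form_block_matrix:
  "z \<bullet> (block_matrix P Q R S *v z) =
    (let (x, y) = split_vec z in x \<bullet> (P *v x) + x \<bullet> (Q *v y) + y \<bullet> (R *v x) + y \<bullet> (S *v y))"
  by (simp add: split_vec_def Let_def inner_vec_def matrix_vector_mult_def block_matrix_def
    sum_UNIV_Plus distrib_left sum.distrib)

lemma measurable_split_vec [measurable]: "split_vec \<in> borel_measurable borel"
  unfolding split_vec_def
  by (intro borel_measurable_continuous_onI continuous_intros)

lemma lborel_distr_split_vec: "distr lborel borel split_vec = lborel"
proof (rule lborel_eqI[symmetric])
  fix l u :: "(real^'n) \<times> (real^'n)"
  assume le: "\<And>b. b \<in> Basis \<Longrightarrow> l \<bullet> b \<le> u \<bullet> b"
  let ?join = "\<lambda>p :: (real^'n) \<times> (real^'n). (\<chi> k. case k of Inl i \<Rightarrow> fst p $ i | Inr i \<Rightarrow> snd p $ i) :: real^('n+'n)"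
  have le': "fst l $ i \<le> fst u $ i" "snd l $ i \<le> snd u $ i" for i
  proof -
    have "axis i 1 \<in> (Basis :: (real^'n) set)" by (auto simp: Basis_vec_def)
    then have "(axis i 1, 0) \<in> (Basis :: ((real^'n) \<times> (real^'n)) set)"
      "(0, axis i 1) \<in> (Basis :: ((real^'n) \<times> (real^'n)) set)"
      unfolding Basis_prod_def by auto
    from le[OF this(1)] le[OF this(2)]
    show "fst l $ i \<le> fst u $ i" "snd l $ i \<le> snd u $ i"
      by (simp_all add: inner_prod_def inner_axis)
  qed
  have box: "split_vec -` box l u = box (?join l) (?join u)"
  proof -
    have "p \<in> box l u \<longleftrightarrow> fst p \<in> box (fst l) (fst u) \<and> snd p \<in> box (snd l) (snd u)" for p
      by (simp add: mem_box Basis_prod_def ball_Un inner_prod_def)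
    then have "split_vec z \<in> box l u \<longleftrightarrow> z \<in> box (?join l) (?join u)" for z
      by (simp add: split_vec_def mem_box_cart split_sum_all)
    then show ?thesis by (intro set_eqI) (simp only: vimage_eq)
  qed
  have "emeasure (distr lborel borel split_vec) (box l u) = emeasure lborel (box (?join l) (?join u))"
    by (simp add: emeasure_distr box)
  also have "\<dots> = ennreal (\<Prod>b\<in>Basis. (?join u - ?join l) \<bullet> b)"
  proof (rule emeasure_lborel_box)
    fix b :: "real^('n + 'n)" assume "b \<in> Basis"
    then obtain k where "b = axis k 1" by (auto simp: Basis_vec_def)
    then show "?join l \<bullet> b \<le> ?join u \<bullet> b" using le' by (cases k) (simp_all add: inner_axis)
  qed
  also have "(\<Prod>b\<in>Basis. (?join u - ?join l) \<bullet> b)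
      = (\<Prod>i\<in>UNIV. fst u $ i - fst l $ i) * (\<Prod>i\<in>UNIV. snd u $ i - snd l $ i)"
    by (simp add: prod_Basis_cart inner_axis prod_UNIV_Plus)
  also have "(\<Prod>i\<in>UNIV. fst u $ i - fst l $ i) * (\<Prod>i\<in>UNIV. snd u $ i - snd l $ i) = (\<Prod>b\<in>Basis. (u - l) \<bullet> b)"
  proof -
    have "inj_on (\<lambda>u::real^'n. (u, 0::real^'n)) Basis" "inj_on (\<lambda>u::real^'n. (0::real^'n, u)) Basis"
      "(\<lambda>u::real^'n. (u, 0::real^'n)) ` Basis \<inter> (\<lambda>u. (0, u)) ` Basis = {}"
      by (auto intro!: inj_onI)
    then show ?thesis
      by (simp add: Basis_prod_def prod.union_disjoint prod.reindex o_def inner_prod_def prod_Basis_cart inner_axis)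
  qed
  finally show "emeasure (distr lborel borel split_vec) (box l u) = ennreal (\<Prod>b\<in>Basis. (u - l) \<bullet> b)" .
qed simp

text \<open>The determinant is left in terms of \<open>\<Sigma>\<close>: only the ratio of this density to the density
  of the optimal plan matters later.\<close>

lemma gaussian_prod_eq_density:
  fixes \<Sigma> :: "real^('d::finite + 'd)^('d + 'd)"
  assumes "matrix_inv \<Sigma> = block_matrix \<Gamma>11 \<Gamma>12 (transpose \<Gamma>12) \<Gamma>22"
  shows "gaussian_prod \<Sigma> = density lborel (\<lambda>(x, y).
     ennreal (exp (- (x \<bullet> (\<Gamma>11 *v x) + 2 * (x \<bullet> (\<Gamma>12 *v y)) + y \<bullet> (\<Gamma>22 *v y)) / 2)
       / sqrt ((2 * pi) ^ (2 * CARD('d)) * det \<Sigma>)))"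
proof -
  let ?r = "\<lambda>(x, y).
     ennreal (exp (- (x \<bullet> (\<Gamma>11 *v x) + 2 * (x \<bullet> (\<Gamma>12 *v y)) + y \<bullet> (\<Gamma>22 *v y)) / 2)
       / sqrt ((2 * pi) ^ (2 * CARD('d)) * det \<Sigma>))"
  have tr: "y \<bullet> (transpose \<Gamma>12 *v x) = x \<bullet> (\<Gamma>12 *v y)" for x y
    by (metis inner_commute inner_matrix_vector_transpose)
  have quad: "z \<bullet> (matrix_inv \<Sigma> *v z) = (case split_vec z of (x, y) \<Rightarrow>
      x \<bullet> (\<Gamma>11 *v x) + 2 * (x \<bullet> (\<Gamma>12 *v y)) + y \<bullet> (\<Gamma>22 *v y))" for z
    unfolding assms quadratic_form_block_matrix
    by (simp add: Let_def split_beta tr del: transpose_matrix_vector)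
  have "gaussian \<Sigma> = density lborel (\<lambda>z. ?r (split_vec z))"
  proof -
    have card: "CARD('d + 'd) = 2 * CARD('d)" by simp
    show ?thesis
      unfolding gaussian_def quad card split_beta ..
  qed
  moreover have "?r \<in> borel_measurable borel"
    unfolding split_beta borel_prod[symmetric] by measurable
  ultimately have "gaussian_prod \<Sigma> = density (distr lborel borel split_vec) ?r"
    unfolding gaussian_prod_def by (subst density_distr) simp_all
  then show ?thesis by (simp add: lborel_distr_split_vec)
qed

lemma nn_integral_shifted_gaussian:
  fixes X :: "real^'n^'n"
  assumes X: "sym_pos_def X"
  shows "(\<integral>\<^sup>+ x. ennreal (exp (- ((x - m) \<bullet> (X *v (x - m))) / 2)) \<partial>lborel)
    = ennreal (sqrt ((2 * pi) ^ CARD('n) * det (matrix_inv X)))"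
proof -
  define N where "N = sqrt ((2 * pi) ^ CARD('n) * det (matrix_inv X))"
  note Xi = sym_pos_def_matrix_inv[OF X]
  have N: "0 < N" using sym_pos_def_det_pos[OF Xi] by (simp add: N_def)
  have inv: "matrix_inv (matrix_inv X) = X"
    using sym_pos_def_invertible[OF X] by (rule matrix_inv_matrix_inv)
  have "(\<integral>\<^sup>+ x. ennreal (exp (- ((x - m) \<bullet> (X *v (x - m))) / 2)) \<partial>lborel)
      = (\<integral>\<^sup>+ x. ennreal (exp (- (x \<bullet> (X *v x)) / 2)) \<partial>lborel)"
    using nn_integral_lborel_translate[of "\<lambda>x. ennreal (exp (- (x \<bullet> (X *v x)) / 2))" "- m"] by simp
  also have "\<dots> = (\<integral>\<^sup>+ x. ennreal N * ennreal (exp (- (x \<bullet> (X *v x)) / 2) / N) \<partial>lborel)"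
    using N by (simp add: ennreal_mult[symmetric])
  also have "\<dots> = ennreal N * emeasure (gaussian (matrix_inv X)) UNIV"
    by (simp add: nn_integral_cmult gaussian_def emeasure_density inv N_def)
  also have "emeasure (gaussian (matrix_inv X)) UNIV = 1"
    using prob_space.emeasure_space_1[OF prob_space_gaussian[OF Xi]] by simp
  finally show ?thesis by (simp add: N_def)
qed

lemma complete_square:
  fixes X :: "real^'n^'n"
  assumes "sym_pos_def X"
  shows "x \<bullet> (X *v x) - 2 * (x \<bullet> v)
    = (x - matrix_inv X *v v) \<bullet> (X *v (x - matrix_inv X *v v)) - v \<bullet> (matrix_inv X *v v)"
proof -
  define w where "w = matrix_inv X *v v"
  have Xw: "X *v w = v"
    using matrix_inv_mult(1)[OF sym_pos_def_invertible[OF assms]] by (simp add: w_def matrix_vector_mul_assoc)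
  have "w \<bullet> (X *v x) = v \<bullet> x"
    using inner_matrix_vector_transpose[of X w x] assms Xw by (simp add: sym_pos_def_def del: transpose_matrix_vector)
  then show ?thesis
    unfolding w_def[symmetric]
    by (simp add: matrix_vector_mult_diff_distrib inner_diff_left inner_diff_right Xw inner_commute)
qed

text \<open>Up to normalization this is the density of the Gaussian measure on the product whose inverse
  covariance has the blocks \<open>X\<close>, \<open>- H\<close> and \<open>Y\<close>.  Completing the square in \<open>x\<close> leaves the quadratic
  form of \<open>Y - H\<^sup>T X\<^sup>-\<^sup>1 H = B\<^sup>-\<^sup>1\<close>, completing it in \<open>y\<close> that of \<open>X - H Y\<^sup>-\<^sup>1 H\<^sup>T = A\<^sup>-\<^sup>1\<close>; in
  both cases the squared term integrates to a constant.\<close>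

lemma gaussian_coupling:
  fixes A B X Y H :: "real^'d^'d"
  defines "q \<equiv> \<lambda>x y. exp (- (x \<bullet> (X *v x) - 2 * (x \<bullet> (H *v y)) + y \<bullet> (Y *v y)) / 2)
       / (sqrt ((2 * pi) ^ CARD('d) * det (matrix_inv X)) * sqrt ((2 * pi) ^ CARD('d) * det B))"
  assumes A: "sym_pos_def A" and B: "sym_pos_def B" and X: "sym_pos_def X" and Y: "sym_pos_def Y"
    and BY: "Y = matrix_inv B + transpose H ** matrix_inv X ** H"
    and AX: "X = matrix_inv A + H ** matrix_inv Y ** transpose H"
  shows "density lborel (\<lambda>(x, y). ennreal (q x y)) \<in> couplings (gaussian A) (gaussian B)"
proof -
  define N where "N S = sqrt ((2 * pi) ^ CARD('d) * det S)" for S :: "real^'d^'d"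
  have N_pos: "0 < N S" if "sym_pos_def S" for S
    using sym_pos_def_det_pos[OF that] by (simp add: N_def)
  note Xi = sym_pos_def_matrix_inv[OF X] and Yi = sym_pos_def_matrix_inv[OF Y]
  let ?\<pi> = "density lborel (\<lambda>(x, y). ennreal (q x y))"
  have q: "q x y = exp (- (x \<bullet> (X *v x) - 2 * (x \<bullet> (H *v y)) + y \<bullet> (Y *v y)) / 2) / (N (matrix_inv X) * N B)" for x y
    by (simp add: q_def N_def)
  have [measurable]: "(\<lambda>(x, y). ennreal (q x y)) \<in> borel_measurable (borel \<Otimes>\<^sub>M borel)"
    unfolding q split_beta by measurable
  define G where "G S x = exp (- (x \<bullet> (matrix_inv S *v x)) / 2)" for S :: "real^'d^'d" and x
  have [measurable]: "G S \<in> borel_measurable borel" for S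
    unfolding G_def by measurable
  have G_mass: "(\<integral>\<^sup>+ x. ennreal (G S x) \<partial>lborel) = ennreal (N S)" if "sym_pos_def S" for S
  proof -
    have "matrix_inv (matrix_inv S) = S"
      using sym_pos_def_invertible[OF that] by (rule matrix_inv_matrix_inv)
    then show ?thesis
      using nn_integral_shifted_gaussian[OF sym_pos_def_matrix_inv[OF that], of 0] by (simp add: G_def N_def)
  qed
  have gauss: "gaussian S = density lborel (\<lambda>x. ennreal (G S x / N S))" for S
    by (simp add: gaussian_def G_def N_def)
  have shifted: "(\<integral>\<^sup>+ x. ennreal (exp (- ((x - m) \<bullet> (S *v (x - m))) / 2) * c) \<partial>lborel)
      = ennreal (N (matrix_inv S)) * ennreal c" if "sym_pos_def S" "0 \<le> c" for S m c
    using that nn_integral_shifted_gaussian[of S m]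
    by (subst ennreal_mult) (simp_all add: nn_integral_multc N_def)
  have G_nonneg: "0 \<le> G S x" for S x by (simp add: G_def)
  have int_x: "(\<integral>\<^sup>+ x. ennreal (q x y) \<partial>lborel) = ennreal (G B y / N B)" for y
  proof -
    have "(H *v y) \<bullet> (matrix_inv X *v (H *v y)) = y \<bullet> (Y *v y) - y \<bullet> (matrix_inv B *v y)"
      unfolding BY by (simp add: inner_matrix_vector_transpose matrix_vector_mul_assoc matrix_mul_assoc
        matrix_vector_mult_add_rdistrib inner_add_right del: transpose_matrix_vector)
    then have "q x y = exp (- ((x - matrix_inv X *v (H *v y)) \<bullet> (X *v (x - matrix_inv X *v (H *v y)))) / 2) * (G B y / (N (matrix_inv X) * N B))" for x
      unfolding q complete_square[OF X] G_def
      by (simp add: exp_add[symmetric] add_divide_distrib diff_divide_distrib)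
    then have "(\<integral>\<^sup>+ x. ennreal (q x y) \<partial>lborel) = ennreal (N (matrix_inv X)) * ennreal (G B y / (N (matrix_inv X) * N B))"
      using N_pos[OF Xi] N_pos[OF B] G_nonneg[of B y] by (simp only:) (subst shifted[OF X], auto)
    also have "\<dots> = ennreal (G B y / N B)"
      using N_pos[OF Xi] N_pos[OF B] by (simp add: ennreal_mult[symmetric] G_def)
    finally show ?thesis .
  qed
  \<comment> \<open>The normalization is adapted to integrating over \<open>x\<close> first, so the other order leaves a constant.\<close>
  define k where "k = N (matrix_inv Y) / (N (matrix_inv X) * N B)"
  have k: "0 < k" using N_pos[OF Xi] N_pos[OF Yi] N_pos[OF B] by (simp add: k_def)
  have int_y: "(\<integral>\<^sup>+ y. ennreal (q x y) \<partial>lborel) = ennreal (k * G A x)" for x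
  proof -
    have xH: "x \<bullet> (H *v y) = y \<bullet> (transpose H *v x)" for y
      by (metis inner_commute inner_matrix_vector_transpose)
    have "(transpose H *v x) \<bullet> (matrix_inv Y *v (transpose H *v x)) = x \<bullet> (X *v x) - x \<bullet> (matrix_inv A *v x)"
      by (subst AX) (simp add: inner_matrix_vector_transpose matrix_vector_mul_assoc matrix_mul_assoc
        matrix_vector_mult_add_rdistrib inner_add_right del: transpose_matrix_vector)
    then have "x \<bullet> (X *v x) - 2 * (x \<bullet> (H *v y)) + y \<bullet> (Y *v y)
        = (y - matrix_inv Y *v (transpose H *v x)) \<bullet> (Y *v (y - matrix_inv Y *v (transpose H *v x))) + x \<bullet> (matrix_inv A *v x)" for y
      using complete_square[OF Y, of y "transpose H *v x"] unfolding xH by linarith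
    then have "q x y = exp (- ((y - matrix_inv Y *v (transpose H *v x)) \<bullet> (Y *v (y - matrix_inv Y *v (transpose H *v x)))) / 2) * (G A x / (N (matrix_inv X) * N B))" for y
      unfolding q G_def
      by (simp add: exp_add[symmetric] add_divide_distrib diff_divide_distrib del: transpose_matrix_vector)
    then have "(\<integral>\<^sup>+ y. ennreal (q x y) \<partial>lborel) = ennreal (N (matrix_inv Y)) * ennreal (G A x / (N (matrix_inv X) * N B))"
      using N_pos[OF Xi] N_pos[OF B] G_nonneg[of A x] by (simp only:) (subst shifted[OF Y], auto)
    also have "\<dots> = ennreal (k * G A x)"
      using N_pos[OF Xi] N_pos[OF B] N_pos[OF Yi] by (simp add: ennreal_mult[symmetric] G_def k_def)
    finally show ?thesis .
  qed
  \<comment> \<open>Both orders of integration give the same total mass, namely 1, and this determines the constant.\<close>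
  have k_eq: "k = 1 / N A"
  proof -
    have "ennreal 1 = (\<integral>\<^sup>+ y. ennreal (G B y / N B) \<partial>lborel)"
      using prob_space.emeasure_space_1[OF prob_space_gaussian[OF B]]
      by (simp add: gauss emeasure_density)
    also have "\<dots> = (\<integral>\<^sup>+ y. (\<integral>\<^sup>+ x. ennreal (q x y) \<partial>lborel) \<partial>lborel)"
      by (simp add: int_x)
    also have "\<dots> = (\<integral>\<^sup>+ x. (\<integral>\<^sup>+ y. ennreal (q x y) \<partial>lborel) \<partial>lborel)"
      by (rule lborel_pair.Fubini') simp
    also have "\<dots> = (\<integral>\<^sup>+ x. ennreal k * ennreal (G A x) \<partial>lborel)"
      using k by (simp add: int_y ennreal_mult G_nonneg)
    also have "\<dots> = ennreal (k * N A)"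
      using k N_pos[OF A] by (simp add: nn_integral_cmult G_mass A ennreal_mult)
    finally show ?thesis
      using k N_pos[OF A] by (simp add: field_simps)
  qed
  have [measurable_cong]: "sets ?\<pi> = sets (borel \<Otimes>\<^sub>M borel)" unfolding borel_prod by simp
  have \<pi>: "?\<pi> = density (lborel \<Otimes>\<^sub>M lborel) (\<lambda>(x, y). ennreal (q x y))"
    by (simp add: lborel_prod)
  have fst: "distr ?\<pi> borel fst = gaussian A"
  proof (rule measure_eqI)
    fix E assume "E \<in> sets (distr ?\<pi> borel fst)"
    then have [measurable]: "E \<in> sets borel" by simp
    have "emeasure (distr ?\<pi> borel fst) E = (\<integral>\<^sup>+ z. indicator E (fst z) \<partial>?\<pi>)"
      by (subst nn_integral_distr[symmetric, of fst _ borel "indicator E"]) simp_all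
    also have "\<dots> = (\<integral>\<^sup>+ x. (\<integral>\<^sup>+ y. ennreal (q x y) * indicator E x \<partial>lborel) \<partial>lborel)"
      unfolding \<pi> by (simp add: nn_integral_density split_beta lborel.nn_integral_fst[symmetric])
    also have "\<dots> = (\<integral>\<^sup>+ x. ennreal (G A x / N A) * indicator E x \<partial>lborel)"
      by (simp add: nn_integral_multc int_y k_eq)
    also have "\<dots> = emeasure (gaussian A) E"
      by (simp add: gauss emeasure_density)
    finally show "emeasure (distr ?\<pi> borel fst) E = emeasure (gaussian A) E" .
  qed simp
  have snd: "distr ?\<pi> borel snd = gaussian B"
  proof (rule measure_eqI)
    fix E assume "E \<in> sets (distr ?\<pi> borel snd)"
    then have [measurable]: "E \<in> sets borel" by simp
    have "emeasure (distr ?\<pi> borel snd) E = (\<integral>\<^sup>+ z. indicator E (snd z) \<partial>?\<pi>)"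
      by (subst nn_integral_distr[symmetric, of snd _ borel "indicator E"]) simp_all
    also have "\<dots> = (\<integral>\<^sup>+ y. (\<integral>\<^sup>+ x. ennreal (q x y) * indicator E y \<partial>lborel) \<partial>lborel)"
      unfolding \<pi> by (simp add: nn_integral_density split_beta lborel_pair.nn_integral_snd[symmetric])
    also have "\<dots> = (\<integral>\<^sup>+ x. ennreal (G B x / N B) * indicator E x \<partial>lborel)"
      by (simp add: nn_integral_multc int_x)
    also have "\<dots> = emeasure (gaussian B) E"
      by (simp add: gauss emeasure_density)
    finally show "emeasure (distr ?\<pi> borel snd) E = emeasure (gaussian B) E" .
  qed simp
  have "prob_space ?\<pi>"
    by (rule prob_space_distrD[of fst _ borel]) (simp_all add: fst prob_space_gaussian A)
  then show ?thesis
    using fst snd by (simp add: couplings_def)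
qed

section \<open>Matrix equations for the optimal plan\<close>

lemma scaleR_matrix_mul_left: "(c *\<^sub>R A) ** B = c *\<^sub>R (A ** B)" for A :: "real^'n^'m" and B :: "real^'p^'n"
  by (simp add: vec_eq_iff matrix_matrix_mult_def sum_distrib_left mult.assoc)

lemma scaleR_matrix_mul_right: "A ** (c *\<^sub>R B) = c *\<^sub>R (A ** B)" for A :: "real^'n^'m" and B :: "real^'p^'n"
  by (simp add: vec_eq_iff matrix_matrix_mult_def sum_distrib_left mult_ac)

lemma trace_scaleR: "trace (c *\<^sub>R A) = c * trace A" for A :: "real^'n^'n"
  by (simp add: trace_def sum_distrib_left)

lemma det_scaleR: "det (c *\<^sub>R A) = c ^ CARD('n) * det A" for A :: "real^'n^'n"
proof -
  have "c *\<^sub>R A = diag_mat (\<lambda>_. c) ** A"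
    by (simp add: vec_eq_iff matrix_matrix_mult_def diag_mat_def if_distrib[of "\<lambda>z. z * _"] cong: if_cong)
  then show ?thesis by (simp add: det_mul det_diag_mat)
qed

text \<open>With \<open>Y = B\<^sup>-\<^sup>1 + H\<^sup>T Z H\<close> the Riccati equation gives \<open>Y B H\<^sup>T Z = H\<^sup>T A\<close>, whence
  \<open>(Z\<^sup>-\<^sup>1 - H Y\<^sup>-\<^sup>1 H\<^sup>T) A = I\<close>.  For \<open>X = Z\<^sup>-\<^sup>1\<close> this is the second of the two equations that
  characterize the marginals of the plan.\<close>

lemma woodbury:
  fixes A B Z H :: "real^'n^'n"
  assumes A: "sym_pos_def A" and B: "sym_pos_def B" and Z: "sym_pos_def Z"
    and A_eq: "A = Z + Z ** H ** B ** transpose H ** Z"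
  shows "matrix_inv Z = matrix_inv A + H ** matrix_inv (matrix_inv B + transpose H ** Z ** H) ** transpose H"
proof -
  define Y where "Y = matrix_inv B + transpose H ** Z ** H"
  have Y: "sym_pos_def Y"
    unfolding Y_def by (intro sym_pos_def_add_congruence sym_pos_def_matrix_inv B Z)
  note invs = matrix_inv_mult[OF sym_pos_def_invertible[OF A]] matrix_inv_mult[OF sym_pos_def_invertible[OF B]]
    matrix_inv_mult[OF sym_pos_def_invertible[OF Z]] matrix_inv_mult[OF sym_pos_def_invertible[OF Y]]
  define L where "L = matrix_inv Z - H ** matrix_inv Y ** transpose H"
  have YB: "Y ** B ** transpose H ** Z = transpose H ** A"
  proof -
    have "Y ** B ** transpose H ** Z = (matrix_inv B ** B) ** transpose H ** Z + transpose H ** Z ** H ** B ** transpose H ** Z"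
      by (simp add: Y_def matrix_add_rdistrib matrix_mul_assoc)
    also have "\<dots> = transpose H ** A"
      by (simp add: invs A_eq matrix_add_ldistrib matrix_mul_assoc)
    finally show ?thesis .
  qed
  have "L ** A = matrix_inv Z ** A - H ** matrix_inv Y ** (transpose H ** A)"
    by (simp add: L_def matrix_sub_rdistrib matrix_mul_assoc)
  also have "H ** matrix_inv Y ** (transpose H ** A) = H ** (matrix_inv Y ** Y) ** B ** transpose H ** Z"
    by (simp add: YB[symmetric] matrix_mul_assoc)
  also have "\<dots> = H ** B ** transpose H ** Z" by (simp add: invs)
  also have "matrix_inv Z ** A = (matrix_inv Z ** Z) + (matrix_inv Z ** Z) ** H ** B ** transpose H ** Z"
    by (subst A_eq) (simp add: matrix_add_ldistrib matrix_mul_assoc)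
  finally have LA: "L ** A = mat 1" by (simp add: invs)
  then have "A ** L = mat 1" by (simp add: matrix_left_right_inverse)
  then have "matrix_inv A = L" by (rule matrix_inv_eqI)
  then show ?thesis by (simp add: L_def Y_def)
qed

text \<open>Put \<open>R = A\<^sup>1\<^sup>/\<^sup>2\<close>, \<open>V = T + \<epsilon>/2 I\<close> and \<open>U = V\<^sup>-\<^sup>1\<close>, where \<open>T\<^sup>2 = R M B M\<^sup>T R + \<epsilon>\<^sup>2/4 I\<close>.  Then
  \<open>R M B M\<^sup>T R + \<epsilon> V = V\<^sup>2\<close>, and conjugating this with \<open>R U\<close> shows that \<open>Z = \<epsilon> R U R\<close> solves the
  Riccati equation.  The traces and the determinant are those that appear in the value of the
  transport problem; they follow since \<open>S = R T R\<^sup>-\<^sup>1\<close> is similar to \<open>T\<close>.\<close>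

lemma schroedinger_matrix:
  fixes A B M :: "real^'d^'d"
  assumes A: "sym_pos_def A" and B: "sym_pos_def B" and \<epsilon>: "0 < \<epsilon>"
  defines "S \<equiv> cross_sqrt A B M \<epsilon>" and "H \<equiv> (1 / \<epsilon>) *\<^sub>R M"
  obtains Z where "sym_pos_def Z" "A = Z + Z ** H ** B ** transpose H ** Z"
    "\<epsilon> * trace (matrix_inv Z ** A) = trace S + \<epsilon> * real CARD('d) / 2"
    "\<epsilon> * trace (transpose H ** Z ** H ** B) = trace S - \<epsilon> * real CARD('d) / 2"
    "det Z = \<epsilon> ^ CARD('d) * det A / det (S + (\<epsilon> / 2) *\<^sub>R mat 1)"
    "0 < det (S + (\<epsilon> / 2) *\<^sub>R mat 1)"
proof -
  define R where "R = msqrt A"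
  define K where "K = transpose M ** R"
  define T where "T = msqrt (R ** M ** B ** transpose M ** R + (\<epsilon>\<^sup>2 / 4) *\<^sub>R mat 1)"
  define V where "V = T + (\<epsilon> / 2) *\<^sub>R mat 1"
  define U where "U = matrix_inv V"
  define Z where "Z = \<epsilon> *\<^sub>R (R ** U ** R)"
  note R = msqrt_sym_pos_def[OF A, folded R_def]
  have Rt: "transpose R = R" using R by (simp add: sym_pos_def_def)
  have "sym_pos_def ((\<epsilon>\<^sup>2 / 4) *\<^sub>R mat 1 + transpose K ** B ** K)"
    using \<epsilon> B by (intro sym_pos_def_add_congruence sym_pos_def_scaleR sym_pos_def_mat_1) auto
  also have "(\<epsilon>\<^sup>2 / 4) *\<^sub>R mat 1 + transpose K ** B ** K = R ** M ** B ** transpose M ** R + (\<epsilon>\<^sup>2 / 4) *\<^sub>R mat 1"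
    by (simp add: K_def matrix_transpose_mul Rt matrix_mul_assoc)
  finally have "sym_pos_def (R ** M ** B ** transpose M ** R + (\<epsilon>\<^sup>2 / 4) *\<^sub>R mat 1)" .
  note T = msqrt_sym_pos_def[OF this, folded T_def]
  have V: "sym_pos_def V"
    using sym_pos_def_add_congruence[OF T(1) sym_pos_def_scaleR[OF sym_pos_def_mat_1, of "\<epsilon>/2"], of "mat 1"] \<epsilon>
    by (simp add: V_def)
  note U = sym_pos_def_matrix_inv[OF V, folded U_def]
  note UV = matrix_inv_mult[OF sym_pos_def_invertible[OF V], folded U_def]
  note RR = matrix_inv_mult[OF sym_pos_def_invertible[OF R(1)]]
  have VV: "R ** M ** B ** transpose M ** R + \<epsilon> *\<^sub>R V = V ** V"
  proof -
    have "V ** V = T ** T + \<epsilon> *\<^sub>R T + (\<epsilon>\<^sup>2 / 4) *\<^sub>R mat 1"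
      by (simp add: V_def matrix_add_ldistrib matrix_add_rdistrib scaleR_matrix_mul_left scaleR_matrix_mul_right
         power2_eq_square vec_eq_iff algebra_simps)
    moreover have "\<epsilon> *\<^sub>R V = \<epsilon> *\<^sub>R T + (\<epsilon>\<^sup>2 / 2) *\<^sub>R mat 1"
      by (simp add: V_def algebra_simps power2_eq_square)
    ultimately show ?thesis
      unfolding T(2) by (simp add: vec_eq_iff algebra_simps)
  qed
  have Z: "sym_pos_def Z"
    unfolding Z_def using sym_pos_def_congruence[OF U sym_pos_def_invertible[OF R(1)]] \<epsilon>
    by (intro sym_pos_def_scaleR) (simp_all add: Rt)
  have A_eq: "A = Z + Z ** H ** B ** transpose H ** Z"
  proof -
    have "Z ** H ** B ** transpose H ** Z = R ** U ** (R ** M ** B ** transpose M ** R) ** U ** R"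
      using \<epsilon> by (simp add: Z_def H_def transpose_scalar scaleR_matrix_mul_left scaleR_matrix_mul_right matrix_mul_assoc)
    also have "\<dots> = R ** U ** (V ** V - \<epsilon> *\<^sub>R V) ** U ** R"
      by (simp add: VV[symmetric])
    also have "\<dots> = R ** (U ** V) ** (V ** U) ** R - \<epsilon> *\<^sub>R (R ** (U ** V) ** U ** R)"
      by (simp add: matrix_sub_ldistrib matrix_sub_rdistrib scaleR_matrix_mul_left scaleR_matrix_mul_right matrix_mul_assoc)
    also have "\<dots> = A - Z" by (simp add: UV R(2) Z_def)
    finally show ?thesis by simp
  qed
  have Zi: "matrix_inv Z = (1 / \<epsilon>) *\<^sub>R (matrix_inv R ** V ** matrix_inv R)"
  proof (rule matrix_inv_eqI)
    have "Z ** ((1 / \<epsilon>) *\<^sub>R (matrix_inv R ** V ** matrix_inv R))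
        = R ** (U ** (R ** matrix_inv R) ** V) ** matrix_inv R"
      using \<epsilon> by (simp add: Z_def scaleR_matrix_mul_left scaleR_matrix_mul_right matrix_mul_assoc)
    then show "Z ** ((1 / \<epsilon>) *\<^sub>R (matrix_inv R ** V ** matrix_inv R)) = mat 1"
      by (simp add: RR UV)
  qed
  have S: "S = R ** T ** matrix_inv R"
    by (simp add: S_def cross_sqrt_def R_def T_def)
  have trS: "trace S = trace T"
  proof -
    have "trace S = trace (T ** (matrix_inv R ** R))"
      unfolding S by (metis matrix_mul_assoc trace_mul_sym)
    then show ?thesis by (simp add: RR)
  qed
  have SV: "S + (\<epsilon> / 2) *\<^sub>R mat 1 = R ** V ** matrix_inv R"
    by (simp add: S V_def matrix_add_ldistrib matrix_add_rdistrib scaleR_matrix_mul_left scaleR_matrix_mul_right RR)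
  have detR: "det R * det (matrix_inv R) = 1"
    by (metis RR(1) det_I det_mul)
  have detV: "det (S + (\<epsilon> / 2) *\<^sub>R mat 1) = det V"
    unfolding SV det_mul using detR by (simp add: mult.assoc mult.left_commute)
  have trV: "trace V = trace S + \<epsilon> * real CARD('d) / 2"
    by (simp add: V_def trace_add trace_scaleR trace_I trS)
  have "trace (matrix_inv Z ** A) = (1 / \<epsilon>) * trace V"
  proof -
    have "matrix_inv Z ** A = (1 / \<epsilon>) *\<^sub>R (matrix_inv R ** V ** (matrix_inv R ** R) ** R)"
      unfolding Zi R(2)[symmetric] by (simp add: scaleR_matrix_mul_left matrix_mul_assoc)
    then have "trace (matrix_inv Z ** A) = (1 / \<epsilon>) * trace (matrix_inv R ** V ** R)"
      by (simp add: RR trace_scaleR)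
    also have "trace (matrix_inv R ** V ** R) = trace (V ** (R ** matrix_inv R))"
      by (metis matrix_mul_assoc trace_mul_sym)
    finally show ?thesis by (simp add: RR)
  qed
  then have tr1: "\<epsilon> * trace (matrix_inv Z ** A) = trace S + \<epsilon> * real CARD('d) / 2"
    using \<epsilon> trV by simp
  have "trace (transpose H ** Z ** H ** B) = (1 / \<epsilon>) * trace (V - \<epsilon> *\<^sub>R mat 1)"
  proof -
    have "transpose H ** Z ** H ** B = (1 / \<epsilon>) *\<^sub>R (transpose M ** R ** U ** (R ** M ** B))"
      using \<epsilon> by (simp add: Z_def H_def transpose_scalar scaleR_matrix_mul_left scaleR_matrix_mul_right matrix_mul_assoc)
    then have "trace (transpose H ** Z ** H ** B) = (1 / \<epsilon>) * trace (transpose M ** R ** U ** (R ** M ** B))"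
      by (simp add: trace_scaleR)
    also have "trace (transpose M ** R ** U ** (R ** M ** B)) = trace (U ** (R ** M ** B ** transpose M ** R))"
      by (metis matrix_mul_assoc trace_mul_sym)
    also have "R ** M ** B ** transpose M ** R = V ** V - \<epsilon> *\<^sub>R V"
      by (simp add: VV[symmetric])
    also have "U ** (V ** V - \<epsilon> *\<^sub>R V) = (U ** V) ** V - \<epsilon> *\<^sub>R (U ** V)"
      by (simp add: matrix_sub_ldistrib scaleR_matrix_mul_right matrix_mul_assoc)
    finally show ?thesis by (simp add: UV)
  qed
  then have tr2: "\<epsilon> * trace (transpose H ** Z ** H ** B) = trace S - \<epsilon> * real CARD('d) / 2"
    using \<epsilon> trV by (simp add: trace_sub trace_scaleR trace_I)
  have detVpos: "0 < det V" using V by (rule sym_pos_def_det_pos)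
  have "det Z = \<epsilon> ^ CARD('d) * det A / det V"
    unfolding Z_def R(2)[symmetric] det_scaleR det_mul U_def det_matrix_inv[OF sym_pos_def_invertible[OF V]] by simp
  with that Z A_eq tr1 tr2 detV detVpos show ?thesis by metis
qed

section \<open>The closed form of the cost\<close>

text \<open>The squared distance is at most \<open>2 \<parallel>x\<parallel>\<^sup>2 + 2 \<parallel>y\<parallel>\<^sup>2\<close>, and the marginals have second moments.\<close>

lemma coupling_quadratic_cost_integrable:
  fixes A B :: "real^'n^'n"
  assumes A: "sym_pos_def A" and B: "sym_pos_def B" and \<pi>: "\<pi> \<in> couplings (gaussian A) (gaussian B)"
  shows "integrable \<pi> (\<lambda>z. (norm (fst z - snd z))\<^sup>2)"
proof -
  have s [measurable_cong]: "sets \<pi> = sets (borel \<Otimes>\<^sub>M borel)" and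
    m: "distr \<pi> borel fst = gaussian A" "distr \<pi> borel snd = gaussian B"
    using \<pi> unfolding borel_prod by (auto simp: couplings_def)
  have sq: "integrable (gaussian S) (\<lambda>x. x \<bullet> x)" if "sym_pos_def S" for S :: "real^'n^'n"
    using gaussian_quadratic_form[OF that, of "mat 1"] by (simp add: has_bochner_integral_iff)
  have "integrable \<pi> (\<lambda>z. fst z \<bullet> fst z)" "integrable \<pi> (\<lambda>z. snd z \<bullet> snd z)"
    using sq[OF A] sq[OF B] unfolding m[symmetric] by (simp_all add: integrable_distr_eq)
  then have "integrable \<pi> (\<lambda>z. 2 * (fst z \<bullet> fst z) + 2 * (snd z \<bullet> snd z))" by auto
  then show ?thesis
  proof (rule Bochner_Integration.integrable_bound)
    have "(norm (x - y))\<^sup>2 \<le> 2 * (x \<bullet> x) + 2 * (y \<bullet> y)" for x y :: "real^'n"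
      using inner_ge_zero[of "x + y"]
      by (simp add: power2_norm_eq_inner inner_diff_left inner_diff_right inner_add_left inner_add_right inner_commute)
    then show "AE z in \<pi>. norm ((norm (fst z - snd z))\<^sup>2) \<le> norm (2 * (fst z \<bullet> fst z) + 2 * (snd z \<bullet> snd z))"
      by (intro AE_I2) (simp add: order_trans[OF _ abs_ge_self])
  qed measurable
qed

theorem corollary3p1:
  fixes A B \<Gamma>11 \<Gamma>12 \<Gamma>22 M :: "real^'d^'d"
    and \<Sigma> :: "real^('d + 'd)^('d + 'd)"
    and \<epsilon> :: real
    and \<mu> \<nu> :: "(real^'d) measure"
  assumes "sym_pos_def A" and "sym_pos_def B"
    and "\<mu> = gaussian A" and "\<nu> = gaussian B"
    and "sym_pos_def \<Sigma>"
    and "\<epsilon> > 0"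
    and "matrix_inv \<Sigma> = block_matrix \<Gamma>11 \<Gamma>12 (transpose \<Gamma>12) \<Gamma>22"
    and "M = mat 1 - \<epsilon> *\<^sub>R \<Gamma>12"
    and "invertible M"
  shows "entropic_cost \<Sigma> \<epsilon> \<mu> \<nu> = ereal (
      trace A + trace B - 2 * trace (cross_sqrt A B M \<epsilon>)
      + \<epsilon> * ln (det (cross_sqrt A B M \<epsilon> + (\<epsilon> / 2) *\<^sub>R mat 1))
      + \<epsilon> * trace (\<Gamma>11 ** A) + \<epsilon> * trace (\<Gamma>22 ** B)
      - \<epsilon> * ln (det (A ** B)) - \<epsilon> * real CARD('d) - \<epsilon> * real CARD('d) * ln \<epsilon>
      - \<epsilon> * ln (det (matrix_inv \<Sigma>)))"
proof -
  note A = assms(1) and B = assms(2) and \<Sigma> = assms(5) and \<epsilon> = assms(6)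
  let ?n = "CARD('d)"
  define S where "S = cross_sqrt A B M \<epsilon>"
  define H where "H = (1 / \<epsilon>) *\<^sub>R M"
  obtain Z where Z: "sym_pos_def Z" and A_eq: "A = Z + Z ** H ** B ** transpose H ** Z"
    and trX: "\<epsilon> * trace (matrix_inv Z ** A) = trace S + \<epsilon> * real ?n / 2"
    and trY: "\<epsilon> * trace (transpose H ** Z ** H ** B) = trace S - \<epsilon> * real ?n / 2"
    and detZ: "det Z = \<epsilon> ^ ?n * det A / det (S + (\<epsilon> / 2) *\<^sub>R mat 1)"
    and detS: "0 < det (S + (\<epsilon> / 2) *\<^sub>R mat 1)"
    using schroedinger_matrix[OF A B \<epsilon>, of M] unfolding S_def H_def by blast
  define X where "X = matrix_inv Z"
  define Y where "Y = matrix_inv B + transpose H ** Z ** H"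
  have X: "sym_pos_def X" unfolding X_def using Z by (rule sym_pos_def_matrix_inv)
  have Xi: "matrix_inv X = Z"
    unfolding X_def using sym_pos_def_invertible[OF Z] by (rule matrix_inv_matrix_inv)
  have Y: "sym_pos_def Y"
    unfolding Y_def by (intro sym_pos_def_add_congruence sym_pos_def_matrix_inv B Z)
  have X_eq: "X = matrix_inv A + H ** matrix_inv Y ** transpose H"
    unfolding X_def Y_def using woodbury[OF A B Z A_eq] .
  note pos = sym_pos_def_det_pos[OF A] sym_pos_def_det_pos[OF B] sym_pos_def_det_pos[OF Z] sym_pos_def_det_pos[OF \<Sigma>]
  \<comment> \<open>\<open>Q\<close> and \<open>G\<close> are the quadratic forms, \<open>q\<close> and \<open>r\<close> the densities of the plan and of the reference measure.\<close>
  define Q where "Q x y = x \<bullet> (X *v x) - 2 * (x \<bullet> (H *v y)) + y \<bullet> (Y *v y)" for x y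
  define G where "G x y = x \<bullet> (\<Gamma>11 *v x) + 2 * (x \<bullet> (\<Gamma>12 *v y)) + y \<bullet> (\<Gamma>22 *v y)" for x y
  define r where "r x y = exp (- G x y / 2) / sqrt ((2 * pi) ^ (2 * ?n) * det \<Sigma>)" for x y
  define q where "q x y = exp (- Q x y / 2) / (sqrt ((2 * pi) ^ ?n * det Z) * sqrt ((2 * pi) ^ ?n * det B))" for x y
  define \<rho> where "\<rho> = gaussian_prod \<Sigma>"
  have \<rho>: "\<rho> = density lborel (\<lambda>(x, y). ennreal (r x y))"
    unfolding \<rho>_def gaussian_prod_eq_density[OF assms(7)] r_def G_def ..
  have meas: "(\<lambda>z. r (fst z) (snd z)) \<in> borel_measurable borel" "(\<lambda>z. q (fst z) (snd z)) \<in> borel_measurable borel"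
    unfolding r_def q_def Q_def G_def borel_prod[symmetric] by measurable
  have q_coupling: "density lborel (\<lambda>(x, y). ennreal (q x y)) \<in> couplings \<mu> \<nu>"
    unfolding q_def Q_def assms(3,4)
    by (rule gaussian_coupling[OF A B X Y _ X_eq, unfolded Xi, OF Y_def])
  \<comment> \<open>The potentials below collect the terms of \<open>\<parallel>x - y\<parallel>\<^sup>2 + 2 \<epsilon> ln (q / r)\<close> in \<open>x\<close> and in \<open>y\<close>; the constant \<open>k\<close>
    comes from the normalizing constants and is put into \<open>\<phi>\<close>.\<close>
  define k where "k = \<epsilon> * (ln (det \<Sigma>) - ln (det Z) - ln (det B))"
  define F1 where "F1 = mat 1 - \<epsilon> *\<^sub>R X + \<epsilon> *\<^sub>R \<Gamma>11"
  define F2 where "F2 = mat 1 - \<epsilon> *\<^sub>R Y + \<epsilon> *\<^sub>R \<Gamma>22"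
  define \<phi> where "\<phi> x = x \<bullet> (F1 *v x) + k" for x
  define \<psi> where "\<psi> y = y \<bullet> (F2 *v y)" for y
  define c where "c z = (norm (fst z - snd z))\<^sup>2" for z :: "(real^'d) \<times> (real^'d)"
  define h where "h z = (\<phi> (fst z) + \<psi> (snd z) - c z) / (2 * \<epsilon>)" for z
  \<comment> \<open>The mixed terms cancel because \<open>\<epsilon> H = M = I - \<epsilon> \<Gamma>\<^sub>1\<^sub>2\<close>.\<close>
  have separable: "c (x, y) + \<epsilon> * (G x y - Q x y) + k = \<phi> x + \<psi> y" for x y
  proof -
    have "\<epsilon> * (x \<bullet> (H *v y)) = x \<bullet> y - \<epsilon> * (x \<bullet> (\<Gamma>12 *v y))"
      using \<epsilon> by (simp add: H_def assms(8) scaleR_matrix_vector_assoc[symmetric] matrix_vector_mult_diff_rdistrib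
        inner_diff_right)
    moreover have "x \<bullet> (F1 *v x) = x \<bullet> x - \<epsilon> * (x \<bullet> (X *v x)) + \<epsilon> * (x \<bullet> (\<Gamma>11 *v x))"
      by (simp add: F1_def matrix_vector_mult_diff_rdistrib matrix_vector_mult_add_rdistrib
        scaleR_matrix_vector_assoc[symmetric] inner_diff_right inner_add_right)
    moreover have "y \<bullet> (F2 *v y) = y \<bullet> y - \<epsilon> * (y \<bullet> (Y *v y)) + \<epsilon> * (y \<bullet> (\<Gamma>22 *v y))"
      by (simp add: F2_def matrix_vector_mult_diff_rdistrib matrix_vector_mult_add_rdistrib
        scaleR_matrix_vector_assoc[symmetric] inner_diff_right inner_add_right)
    moreover have "c (x, y) = x \<bullet> x - 2 * (x \<bullet> y) + y \<bullet> y"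
      by (simp add: c_def power2_norm_eq_inner inner_diff_left inner_diff_right inner_commute)
    moreover have "\<epsilon> * (G x y - Q x y) = \<epsilon> * (x \<bullet> (\<Gamma>11 *v x)) + 2 * (\<epsilon> * (x \<bullet> (\<Gamma>12 *v y)))
        + \<epsilon> * (y \<bullet> (\<Gamma>22 *v y)) - \<epsilon> * (x \<bullet> (X *v x)) + 2 * (\<epsilon> * (x \<bullet> (H *v y))) - \<epsilon> * (y \<bullet> (Y *v y))"
      unfolding G_def Q_def by (simp only: distrib_left right_diff_distrib mult.left_commute[of \<epsilon> 2])
    ultimately show ?thesis
      unfolding \<phi>_def \<psi>_def by linarith
  qed
  have ratio: "r x y * exp (h (x, y)) = q x y" for x y
  proof -
    have "k / (2 * \<epsilon>) = ln (sqrt (det \<Sigma>) / (sqrt (det Z) * sqrt (det B)))"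
      using pos \<epsilon> by (simp add: k_def ln_div ln_mult ln_sqrt field_simps)
    then have "exp (k / (2 * \<epsilon>)) = sqrt (det \<Sigma>) / (sqrt (det Z) * sqrt (det B))"
      using pos by simp
    moreover have "h (x, y) = k / (2 * \<epsilon>) + - Q x y / 2 - - G x y / 2"
      using separable[of x y] \<epsilon> by (simp add: h_def field_simps)
    ultimately have exp_h: "exp (h (x, y))
        = sqrt (det \<Sigma>) / (sqrt (det Z) * sqrt (det B)) * exp (- Q x y / 2) / exp (- G x y / 2)"
      by (simp only: exp_add exp_diff)
    have "sqrt ((2 * pi) ^ (2 * ?n) * det \<Sigma>) = (2 * pi) ^ ?n * sqrt (det \<Sigma>)"
      unfolding real_sqrt_mult mult.commute[of 2 ?n] power_mult by simp
    moreover have "sqrt ((2 * pi) ^ ?n * det Z) * sqrt ((2 * pi) ^ ?n * det B)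
        = (sqrt ((2 * pi) ^ ?n) * sqrt ((2 * pi) ^ ?n)) * (sqrt (det Z) * sqrt (det B))"
      unfolding real_sqrt_mult by (simp only: ac_simps)
    moreover have "sqrt ((2 * pi) ^ ?n) * sqrt ((2 * pi) ^ ?n) = (2 * pi) ^ ?n"
      by (intro real_sqrt_mult_self[THEN trans]) simp
    moreover have "(2 * pi) ^ ?n \<noteq> 0" "sqrt (det \<Sigma>) \<noteq> 0" using pos by auto
    ultimately show ?thesis
      unfolding r_def q_def exp_h by (simp add: divide_simps)
  qed
  have [measurable]: "\<phi> \<in> borel_measurable borel" "\<psi> \<in> borel_measurable borel" "c \<in> borel_measurable borel"
    unfolding \<phi>_def \<psi>_def c_def by measurable
  have [measurable]: "h \<in> borel_measurable borel"
    unfolding h_def by measurable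
  have opt: "density \<rho> (\<lambda>z. ennreal (exp (h z))) \<in> couplings \<mu> \<nu>"
  proof -
    have "0 \<le> r x y" for x y using pos by (simp add: r_def)
    then have "ennreal (r (fst z) (snd z)) * ennreal (exp (h z)) = ennreal (q (fst z) (snd z))" for z
      using ratio[of "fst z" "snd z"] by (subst ennreal_mult[symmetric]) simp_all
    then have "density \<rho> (\<lambda>z. ennreal (exp (h z))) = density lborel (\<lambda>(x, y). ennreal (q x y))"
      unfolding \<rho> split_beta using meas by (subst density_density_eq) auto
    then show ?thesis using q_coupling by (simp only:)
  qed
  have sf: "sigma_finite_measure \<rho>"
    unfolding \<rho>_def gaussian_prod_def
    by (intro prob_space_imp_sigma_finite prob_space.prob_space_distr prob_space_gaussian \<Sigma>) simp
  have \<phi>_int: "has_bochner_integral \<mu> \<phi> (trace (F1 ** A) + k)"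
  proof -
    interpret prob_space \<mu> unfolding assms(3) using A by (rule prob_space_gaussian)
    have "has_bochner_integral \<mu> (\<lambda>x. k) k"
      by (simp add: has_bochner_integral_iff prob_space)
    then show ?thesis
      unfolding \<phi>_def[abs_def] assms(3) by (intro has_bochner_integral_add gaussian_quadratic_form A)
  qed
  have \<psi>_int: "has_bochner_integral \<nu> \<psi> (trace (F2 ** B))"
    unfolding \<psi>_def[abs_def] assms(4) by (intro gaussian_quadratic_form B)
  have "entropic_cost \<Sigma> \<epsilon> \<mu> \<nu> = (INF \<pi> \<in> couplings \<mu> \<nu>. enn2ereal (\<integral>\<^sup>+ z. ennreal (c z) \<partial>\<pi>) + ereal (2 * \<epsilon>) * KL \<pi> \<rho>)"
    unfolding entropic_cost_def \<rho>_def c_def split_beta ..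
  also have "\<dots> = ereal ((\<integral>x. \<phi> x \<partial>\<mu>) + (\<integral>y. \<psi> y \<partial>\<nu>))"
  proof (rule entropic_duality[OF sf _ \<epsilon>])
    show "sets \<rho> = sets borel" unfolding \<rho> by simp
    show "integrable \<mu> \<phi>" "integrable \<nu> \<psi>"
      using \<phi>_int \<psi>_int by (auto simp: has_bochner_integral_iff)
    show "integrable \<pi> c" if "\<pi> \<in> couplings \<mu> \<nu>" for \<pi>
      using coupling_quadratic_cost_integrable[OF A B, of \<pi>] that unfolding c_def assms(3,4) .
    show "density \<rho> (\<lambda>z. ennreal (exp ((\<phi> (fst z) + \<psi> (snd z) - c z) / (2 * \<epsilon>)))) \<in> couplings \<mu> \<nu>"
      using opt unfolding h_def .
    show "0 \<le> c z" for z by (simp add: c_def)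
  qed measurable
  also have "(\<integral>x. \<phi> x \<partial>\<mu>) = trace (F1 ** A) + k"
    using \<phi>_int by (simp add: has_bochner_integral_iff)
  also have "(\<integral>x. \<psi> x \<partial>\<nu>) = trace (F2 ** B)"
    using \<psi>_int by (simp add: has_bochner_integral_iff)
  also have "trace (F1 ** A) + k + trace (F2 ** B) = 
      trace A + trace B - 2 * trace S
      + \<epsilon> * ln (det (S + (\<epsilon> / 2) *\<^sub>R mat 1))
      + \<epsilon> * trace (\<Gamma>11 ** A) + \<epsilon> * trace (\<Gamma>22 ** B)
      - \<epsilon> * ln (det (A ** B)) - \<epsilon> * real CARD('d) - \<epsilon> * real CARD('d) * ln \<epsilon>
      - \<epsilon> * ln (det (matrix_inv \<Sigma>))"
  proof -
    have "trace (F1 ** A) = trace A - (trace S + \<epsilon> * real ?n / 2) + \<epsilon> * trace (\<Gamma>11 ** A)"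
      unfolding F1_def trX[symmetric]
      by (simp add: matrix_add_rdistrib matrix_sub_rdistrib trace_add trace_sub scaleR_matrix_mul_left trace_scaleR X_def)
    moreover have "trace (F2 ** B) = trace B - \<epsilon> * ?n - (trace S - \<epsilon> * real ?n / 2) + \<epsilon> * trace (\<Gamma>22 ** B)"
      unfolding F2_def trY[symmetric]
      by (simp add: matrix_add_rdistrib matrix_sub_rdistrib trace_add trace_sub scaleR_matrix_mul_left trace_scaleR
        Y_def scaleR_right_distrib matrix_inv_mult sym_pos_def_invertible[OF B] trace_I)
    moreover have "\<epsilon> * ln (det Z) = \<epsilon> * real ?n * ln \<epsilon> + \<epsilon> * ln (det A) - \<epsilon> * ln (det (S + (\<epsilon> / 2) *\<^sub>R mat 1))"
    proof -
      have "ln (det Z) = real ?n * ln \<epsilon> + ln (det A) - ln (det (S + (\<epsilon> / 2) *\<^sub>R mat 1))"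
        unfolding detZ using \<epsilon> pos detS by (simp add: ln_div ln_mult ln_realpow)
      then show ?thesis by (simp only: distrib_left right_diff_distrib mult.assoc)
    qed
    moreover have "ln (det (A ** B)) = ln (det A) + ln (det B)"
      using pos by (simp add: det_mul ln_mult)
    moreover have "ln (det (matrix_inv \<Sigma>)) = - ln (det \<Sigma>)"
      using pos by (simp add: det_matrix_inv sym_pos_def_invertible[OF \<Sigma>] ln_div)
    ultimately show ?thesis
      unfolding k_def by (simp add: right_diff_distrib distrib_left)
  qed
  finally show ?thesis unfolding S_def .
qed

end
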